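(* Let $\Sigma\subset\mathbb{R}^2\times\mathbb{R}$ (Euclidean $\mathbb{R}^3$) be a doubly connected minimal graph, i.e. $\Sigma=\{(u,v,\omega(u,v)):(u,v)\in\Omega\}$ for a doubly connected domain $\Omega\subset\mathbb{R}^2$ and a function $\omega$ satisfying the minimal surface equation, whose boundary consists of two Jordan curves $\gamma_1,\gamma_2$ lying in two horizontal planes $\Pi_1,\Pi_2$ whose distance is $\mathbf{d}>0$. Let $\Pi$ be the horizontal plane equidistant from $\Pi_1$ and $\Pi_2$. Then for every point $\zeta\in\Sigma\cap\Pi$ the Gaussian curvature of $\Sigma$ satisfies $$|\mathcal{K}_\Sigma(\zeta)|\le\frac{\pi^2}{\mathbf{d}^2}.$$ Moreover, the tangent plane $T_\zeta\Sigma$ at any point $\zeta\in\Sigma\setminus(\gamma_1\cup\gamma_2)$ is neither horizontal nor vertical.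
   Context: The minimal surface equation for $\omega$ is $\mathrm{div}\big(\nabla\omega/\sqrt{1+|\nabla\omega|^2}\big)=0$. A plane is horizontal if it is of the form $\mathbb{R}^2\times\{t\}$, and vertical if it contains the vertical direction $(0,0,1)$. *)

theory Defs
  imports "HOL-Analysis.Analysis"
begin

definition pd1 :: "(real \<times> real \<Rightarrow> real) \<Rightarrow> real \<times> real \<Rightarrow> real" where
  "pd1 f p = frechet_derivative f (at p) (1, 0)"

definition pd2 :: "(real \<times> real \<Rightarrow> real) \<Rightarrow> real \<times> real \<Rightarrow> real" where
  "pd2 f p = frechet_derivative f (at p) (0, 1)"

definition C2_on :: "(real \<times> real) set \<Rightarrow> (real \<times> real \<Rightarrow> real) \<Rightarrow> bool" where
  "C2_on \<Omega> f \<longleftrightarrow>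
     (\<forall>p\<in>\<Omega>. f differentiable (at p)) \<and>
     (\<forall>p\<in>\<Omega>. pd1 f differentiable (at p) \<and> pd2 f differentiable (at p)) \<and>
     continuous_on \<Omega> (pd1 (pd1 f)) \<and> continuous_on \<Omega> (pd2 (pd1 f)) \<and>
     continuous_on \<Omega> (pd1 (pd2 f)) \<and> continuous_on \<Omega> (pd2 (pd2 f))"

definition minimal_surface_eq :: "(real \<times> real) set \<Rightarrow> (real \<times> real \<Rightarrow> real) \<Rightarrow> bool" where
  "minimal_surface_eq \<Omega> w \<longleftrightarrow>
     (\<forall>p\<in>\<Omega>.
        pd1 (\<lambda>q. pd1 w q / sqrt (1 + (pd1 w q)\<^sup>2 + (pd2 w q)\<^sup>2)) p
      + pd2 (\<lambda>q. pd2 w q / sqrt (1 + (pd1 w q)\<^sup>2 + (pd2 w q)\<^sup>2)) p = 0)"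

text \<open>Doubly connected domain in the plane (used for bounded domains): open, connected,
  and its complement has exactly two connected components.\<close>
definition doubly_connected_domain :: "(real \<times> real) set \<Rightarrow> bool" where
  "doubly_connected_domain \<Omega> \<longleftrightarrow>
     open \<Omega> \<and> connected \<Omega> \<and> card (components (UNIV - \<Omega>)) = 2"

definition graph_over :: "(real \<times> real \<Rightarrow> real) \<Rightarrow> (real \<times> real) set \<Rightarrow> ((real \<times> real) \<times> real) set" where
  "graph_over w A = (\<lambda>p. (p, w p)) ` A"

definition jordan_curve :: "((real \<times> real) \<times> real) set \<Rightarrow> bool" where
  "jordan_curve \<gamma> \<longleftrightarrow>
     (\<exists>g. simple_path g \<and> pathfinish g = pathstart g \<and> path_image g = \<gamma>)"

definition horizontal_plane_at :: "real \<Rightarrow> ((real \<times> real) \<times> real) set" where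
  "horizontal_plane_at t = UNIV \<times> {t}"

definition horizontal :: "((real \<times> real) \<times> real) set \<Rightarrow> bool" where
  "horizontal P \<longleftrightarrow> (\<exists>t. P = horizontal_plane_at t)"

definition vertical :: "((real \<times> real) \<times> real) set \<Rightarrow> bool" where
  "vertical P \<longleftrightarrow> (\<forall>x\<in>P. \<forall>s::real. x + s *\<^sub>R ((0, 0), 1) \<in> P)"

definition tangent_plane :: "(real \<times> real \<Rightarrow> real) \<Rightarrow> real \<times> real \<Rightarrow> ((real \<times> real) \<times> real) set" where
  "tangent_plane w p =
     (\<lambda>x. (p, w p) + x) ` span {((1, 0), pd1 w p), ((0, 1), pd2 w p)}"

text \<open>Gaussian curvature of the graph of w at (p, w p), computed from the first
  fundamental form (E,F,G) and second fundamental form (L,M,N) of the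
  parametrisation X(u,v) = (u,v,w(u,v)) with upward unit normal.\<close>
definition gauss_curvature_graph :: "(real \<times> real \<Rightarrow> real) \<Rightarrow> real \<times> real \<Rightarrow> real" where
  "gauss_curvature_graph w p =
     (let wu = pd1 w p; wv = pd2 w p;
          E = 1 + wu\<^sup>2; F = wu * wv; G = 1 + wv\<^sup>2;
          W = sqrt (E * G - F\<^sup>2);
          L = pd1 (pd1 w) p / W; M = pd2 (pd1 w) p / W; N = pd2 (pd2 w) p / W
      in (L * N - M\<^sup>2) / (E * G - F\<^sup>2))"

end

theory Submission
  imports Defs "HOL-Complex_Analysis.Complex_Analysis"
begin

text \<open>
  On a minimal graph the coordinate functions are harmonic for the induced conformal structure:
  near every point \<open>x\<close> and its conjugate form a conformal chart, and in it both
  \<open>f = \<omega> + i \<omega>\<^sup>*\<close> and the stereographic Gauss map \<open>g\<close>, with values in the unit disc, are holomorphic.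

  There is no critical point of the height: at such a point \<open>\<omega> - c = Re \<phi>\<^sup>n\<close> with \<open>n \<ge> 2\<close>, so the sets
  \<open>\<omega> > c\<close> and \<open>\<omega> < c\<close> each have at least two sectors, interlaced. But both sets are
  connected, because by the maximum principle each of their components reaches the same boundary
  curve; two interlaced connected open sets of this kind cannot exist in the plane, by Janiszewski's theorem.

  Hence \<open>f\<close> maps locally conformally to the strip between the two planes, and Ahlfors' form of
  the Schwarz lemma compares the hyperbolic metric of the disc, pulled back by \<open>g\<close>, with that of the strip,
  pulled back by \<open>f\<close>. Both densities are globally defined on the domain, so neither a universal cover nor
  a uniformization is needed. On the middle plane the comparison reads
  \<open>s\<^sup>2 - r t \<le> \<pi>\<^sup>2 (p\<^sup>2 + q\<^sup>2) / d\<^sup>2\<close> in Monge's notation for the derivatives of \<open>\<omega>\<close>.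
\<close>

subsection \<open>Closed forms and partial derivatives in the plane\<close>

text \<open>Conjugate functions may have periods around the annulus, so \<open>f\<close> and the
  chart exist only locally; what is global is the quotient \<open>gauss_density\<close> of the two
  squared densities, a rational expression in p, q, r, s, t. It has p^2 + q^2 in the denominator, so
  the absence of critical points comes first: it settles the horizontal tangent planes and makes the
  quotient continuous. Ahlfors' argument needs a maximum, but nothing controls the quotient near the
  boundary curves, where \<omega> is only continuous. The strip is therefore replaced by a
  concentric one of width d < t2 - t1: the weight cos^2 (pi (\<omega> - m) / d) vanishes on the two
  levels bounding a compact part of \<Omega>, so a positive maximum is attained strictly between
  them. Then d tends to t2 - t1. The constant is that of the strip: its density of curvature -1 is
  (pi / d) / cos (pi (x - m) / d), which equals pi / d on the axis, and the middle plane corresponds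
  to the axis. The passage to curvature uses |K| = (s^2 - r t) / W^4 and p^2 + q^2 = W^2 - 1 \<le>
  W^4. Vertical tangent planes are excluded for any graph.\<close>

lemma differentiable_has_derivative_pd:
  assumes "f differentiable (at p)"
  shows "(f has_derivative (\<lambda>v. fst v * pd1 f p + snd v * pd2 f p)) (at p)"
proof -
  let ?D = "frechet_derivative f (at p)"
  have D: "(f has_derivative ?D) (at p)"
    using assms frechet_derivative_works by blast
  interpret bounded_linear ?D using D by (rule has_derivative_bounded_linear)
  have "?D v = fst v * pd1 f p + snd v * pd2 f p" for v
  proof -
    have "?D v = ?D (fst v *\<^sub>R (1, 0) + snd v *\<^sub>R (0, 1))" by simp
    also have "\<dots> = fst v * pd1 f p + snd v * pd2 f p"
      unfolding add scaleR by (simp add: pd1_def pd2_def)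
    finally show ?thesis .
  qed
  then have "?D = (\<lambda>v. fst v * pd1 f p + snd v * pd2 f p)" by (rule ext)
  then show ?thesis using D by simp
qed

lemma has_derivative_pd_eq:
  assumes "(f has_derivative (\<lambda>v. fst v * a + snd v * b)) (at p)"
  shows "pd1 f p = a" "pd2 f p = b"
  using frechet_derivative_at[OF assms, symmetric] unfolding pd1_def pd2_def by simp_all

lemma has_derivative_sections:
  fixes f :: "real \<times> real \<Rightarrow> 'a::real_normed_vector"
  assumes "(f has_derivative (\<lambda>v. fst v *\<^sub>R a + snd v *\<^sub>R b)) (at (x, y))"
  shows "((\<lambda>s. f (s, y)) has_vector_derivative a) (at x)"
    and "((\<lambda>t. f (x, t)) has_vector_derivative b) (at y)"
proof -
  have 1: "((\<lambda>s::real. (s, y)) has_derivative (\<lambda>h. (h, 0))) (at x)"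
    by (auto intro!: derivative_eq_intros)
  have 2: "((\<lambda>t::real. (x, t)) has_derivative (\<lambda>h. (0, h))) (at y)"
    by (auto intro!: derivative_eq_intros)
  show "((\<lambda>s. f (s, y)) has_vector_derivative a) (at x)"
    using diff_chain_at[OF 1 assms] by (simp add: o_def has_vector_derivative_def)
  show "((\<lambda>t. f (x, t)) has_vector_derivative b) (at y)"
    using diff_chain_at[OF 2 assms] by (simp add: o_def has_vector_derivative_def)
qed

lemma has_real_derivative_pd:
  assumes "f differentiable (at (x, y))"
  shows "((\<lambda>s. f (s, y)) has_real_derivative pd1 f (x, y)) (at x)"
    and "((\<lambda>t. f (x, t)) has_real_derivative pd2 f (x, y)) (at y)"
  using has_derivative_sections[of f "pd1 f (x, y)" "pd2 f (x, y)"]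
    differentiable_has_derivative_pd[OF assms]
  by (auto simp: has_real_derivative_iff_has_vector_derivative)

lemma continuous_on_section:
  assumes "continuous_on (A \<times> B) f" "x \<in> A"
  shows "continuous_on B (\<lambda>t. f (x, t))"
  by (rule continuous_on_compose2[OF assms(1)]) (use assms(2) in \<open>auto intro!: continuous_intros\<close>)

lemma mem_box_Pair:
  "z \<in> box (a, c) (b, e) \<longleftrightarrow> fst z \<in> {a<..<b} \<and> snd z \<in> {c<..<e}" for a b c e :: real
  by (auto simp: box_def Basis_prod_def inner_prod_def)

text \<open>Split the increment into a move in each variable: the move in the second variable starts
  away from the base point, so its partial \<open>Q\<close> has to be continuous, while for the
  first variable the derivative at the point suffices.\<close>

lemma has_derivative_continuous_partials:
  fixes F :: "real \<times> real \<Rightarrow> real"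
  assumes "open S" "convex S" "open T" "convex T" "x \<in> S" "y \<in> T"
    and Fx: "\<And>x y. x \<in> S \<Longrightarrow> y \<in> T \<Longrightarrow> ((\<lambda>s. F (s, y)) has_real_derivative P (x, y)) (at x)"
    and Fy: "\<And>x y. x \<in> S \<Longrightarrow> y \<in> T \<Longrightarrow> ((\<lambda>t. F (x, t)) has_real_derivative Q (x, y)) (at y)"
    and Q: "continuous_on (S \<times> T) Q"
  shows "(F has_derivative (\<lambda>v. fst v * P (x, y) + snd v * Q (x, y))) (at (x, y))"
proof -
  have op: "open (S \<times> T)" using assms by (intro open_Times)
  have "((\<lambda>(x, y). (\<lambda>x y. F (x, y)) x y) has_derivative
       (\<lambda>(tx, ty). (*) (P (x, y)) tx + blinfun_mult_right (Q (x, y)) ty)) (at (x, y) within S \<times> T)"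
  proof (rule has_derivative_partialsI)
    show "((\<lambda>x. F (x, y)) has_derivative (*) (P (x, y))) (at x within S)"
      using Fx[OF \<open>x \<in> S\<close> \<open>y \<in> T\<close>] has_derivative_at_withinI
      unfolding has_field_derivative_def by blast
    show "((\<lambda>y. F (x, y)) has_derivative blinfun_apply (blinfun_mult_right (Q (x, y)))) (at y within T)"
      if "x \<in> S" "y \<in> T" for x y
      using Fy[OF that] has_derivative_at_withinI
      unfolding has_field_derivative_def by (force simp: blinfun_mult_right.rep_eq)
    have "continuous_on (S \<times> T) (\<lambda>z. blinfun_mult_right (Q z))"
      by (rule bounded_linear.continuous_on[OF bounded_linear_blinfun_mult_right Q])
    then show "continuous (at (x, y) within S \<times> T) (\<lambda>(x, y). blinfun_mult_right (Q (x, y)))"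
      using \<open>x \<in> S\<close> \<open>y \<in> T\<close> by (simp add: continuous_on_eq_continuous_within case_prod_unfold)
  qed (use assms in auto)
  then show ?thesis
    using at_within_open[of "(x, y)" "S \<times> T"] op \<open>x \<in> S\<close> \<open>y \<in> T\<close>
    by (simp add: case_prod_unfold mult.commute)
qed

lemma integral_partial:
  fixes Q :: "real \<times> real \<Rightarrow> real"
  assumes "x \<in> {a<..<b}"
    and Qx: "\<And>x y. x \<in> {a<..<b} \<Longrightarrow> y \<in> {c..e} \<Longrightarrow> ((\<lambda>s. Q (s, y)) has_real_derivative Q' (x, y)) (at x)"
    and Q: "continuous_on ({a<..<b} \<times> {c..e}) Q" and Q': "continuous_on ({a<..<b} \<times> {c..e}) Q'"
  shows "((\<lambda>s. integral {c..e} (\<lambda>t. Q (s, t))) has_real_derivative integral {c..e} (\<lambda>t. Q' (x, t))) (at x)"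
proof -
  have "((\<lambda>s. integral (cbox c e) (\<lambda>t. Q (s, t))) has_field_derivative integral (cbox c e) (\<lambda>t. Q' (x, t)))
      (at x within {a<..<b})"
  proof (rule leibniz_rule_field_derivative)
    show "((\<lambda>x. Q (x, t)) has_real_derivative Q' (x, t)) (at x within {a<..<b})"
      if "x \<in> {a<..<b}" "t \<in> cbox c e" for x t
      using Qx[of x t] that by (auto intro: has_field_derivative_at_within)
    show "(\<lambda>t. Q (x, t)) integrable_on cbox c e" if "x \<in> {a<..<b}" for x
      using continuous_on_section[OF Q that] by (auto intro: integrable_continuous_interval)
  qed (use assms in auto)
  then show ?thesis using assms(1) by (simp add: at_within_open[of x "{a<..<b}"])
qed

text \<open>Integrating along the axis-parallel path from the corner makes the derivative in the second
  variable immediate; closedness enters only through the derivative in the first one.\<close>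

lemma closed_form_primitive_box:
  fixes P Q :: "real \<times> real \<Rightarrow> real"
  assumes sub: "cbox (a, c) (b, e) \<subseteq> \<Omega>" and op: "open \<Omega>"
    and dP: "\<And>z. z \<in> \<Omega> \<Longrightarrow> P differentiable (at z)"
    and dQ: "\<And>z. z \<in> \<Omega> \<Longrightarrow> Q differentiable (at z)"
    and cQ: "continuous_on \<Omega> (pd1 Q)"
    and cl: "\<And>z. z \<in> \<Omega> \<Longrightarrow> pd1 Q z = pd2 P z"
  shows "\<exists>F. \<forall>z\<in>box (a, c) (b, e). (F has_derivative (\<lambda>v. fst v * P z + snd v * Q z)) (at z)"
proof -
  have sub': "{a..b} \<times> {c..e} \<subseteq> \<Omega>" using sub by (simp add: cbox_Pair_eq)
  have P: "continuous_on ({a..b} \<times> {c..e}) P" and Q: "continuous_on ({a..b} \<times> {c..e}) Q"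
    using sub' dP dQ by (meson continuous_at_imp_continuous_on differentiable_imp_continuous_within subsetD)+
  have Q1: "continuous_on ({a..b} \<times> {c..e}) (pd1 Q)" using cQ sub' continuous_on_subset by blast
  define F where "F = (\<lambda>(x, y). integral {a..x} (\<lambda>s. P (s, c)) + integral {c..y} (\<lambda>t. Q (x, t)))"
  have Fy: "((\<lambda>t. F (x, t)) has_real_derivative Q (x, y)) (at y)" if "x \<in> {a<..<b}" "y \<in> {c<..<e}" for x y
  proof -
    have "continuous_on {c..e} (\<lambda>t. Q (x, t))"
      by (rule continuous_on_section[OF Q]) (use that in auto)
    from integral_has_real_derivative[OF this, of y]
    have "((\<lambda>u. integral {c..u} (\<lambda>t. Q (x, t))) has_real_derivative Q (x, y)) (at y)"
      using that by (simp add: at_within_Icc_at)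
    then show ?thesis unfolding F_def by (auto intro!: derivative_eq_intros)
  qed
  have Fx: "((\<lambda>s. F (s, y)) has_real_derivative P (x, y)) (at x)" if "x \<in> {a<..<b}" "y \<in> {c<..<e}" for x y
  proof -
    have "continuous_on {a..b} (\<lambda>s. P (s, c))"
      by (rule continuous_on_compose2[OF P]) (use that in \<open>auto intro!: continuous_intros\<close>)
    from integral_has_real_derivative[OF this, of x]
    have 1: "((\<lambda>u. integral {a..u} (\<lambda>s. P (s, c))) has_real_derivative P (x, c)) (at x)"
      using that by (simp add: at_within_Icc_at)
    have 2: "((\<lambda>s. integral {c..y} (\<lambda>t. Q (s, t))) has_real_derivative integral {c..y} (\<lambda>t. pd1 Q (x, t))) (at x)"
    proof (rule integral_partial[OF that(1)])
      show "((\<lambda>s. Q (s, y')) has_real_derivative pd1 Q (x, y')) (at x)"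
        if "x \<in> {a<..<b}" "y' \<in> {c..y}" for x y'
      proof -
        have "(x, y') \<in> \<Omega>" using that sub' \<open>y \<in> {c<..<e}\<close> by auto
        then show ?thesis by (intro has_real_derivative_pd dQ)
      qed
    qed (use that in \<open>auto intro!: continuous_on_subset[OF Q] continuous_on_subset[OF Q1]\<close>)
    have "((\<lambda>t. pd2 P (x, t)) has_integral (P (x, y) - P (x, c))) {c..y}"
    proof (rule fundamental_theorem_of_calculus)
      show "((\<lambda>t. P (x, t)) has_vector_derivative pd2 P (x, t)) (at t within {c..y})"
        if "t \<in> {c..y}" for t
      proof -
        have "(x, t) \<in> \<Omega>" using that sub' \<open>x \<in> {a<..<b}\<close> \<open>y \<in> {c<..<e}\<close> by auto
        from has_real_derivative_pd(2)[OF dP[OF this]] show ?thesis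
          using has_field_derivative_at_within has_real_derivative_iff_has_vector_derivative by blast
      qed
    qed (use that in auto)
    moreover have "integral {c..y} (\<lambda>t. pd1 Q (x, t)) = integral {c..y} (\<lambda>t. pd2 P (x, t))"
    proof (rule integral_cong)
      show "pd1 Q (x, t) = pd2 P (x, t)" if "t \<in> {c..y}" for t
        using that sub' \<open>x \<in> {a<..<b}\<close> \<open>y \<in> {c<..<e}\<close> by (intro cl) auto
    qed
    ultimately have "integral {c..y} (\<lambda>t. pd1 Q (x, t)) = P (x, y) - P (x, c)"
      by (simp add: integral_unique)
    then show ?thesis using DERIV_add[OF 1 2] by (simp add: F_def)
  qed
  have "(F has_derivative (\<lambda>v. fst v * P z + snd v * Q z)) (at z)" if "z \<in> box (a, c) (b, e)" for z
  proof -
    obtain x y where z: "z = (x, y)" by fastforce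
    show ?thesis unfolding z
    proof (rule has_derivative_continuous_partials[where S = "{a<..<b}" and T = "{c<..<e}"])
      show "continuous_on ({a<..<b} \<times> {c<..<e}) Q" by (rule continuous_on_subset[OF Q]) auto
    qed (use that z Fx Fy in \<open>auto simp: mem_box_Pair\<close>)
  qed
  then show ?thesis by blast
qed

lemma open_contains_nondegenerate_cbox:
  fixes z :: "real \<times> real"
  assumes "open \<Omega>" "z \<in> \<Omega>"
  obtains a b c e where "cbox (a, c) (b, e) \<subseteq> \<Omega>" "z \<in> box (a, c) (b, e)"
proof -
  obtain u v where "z \<in> box u v" "cbox u v \<subseteq> \<Omega>"
    using open_contains_cbox[OF assms] by metis
  with that[of "fst u" "snd u" "fst v" "snd v"] show ?thesis by simp
qed

text \<open>The difference between \<open>f\<close> and the integral of \<open>pd2 f\<close> along vertical segments depends on the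
  first variable only, so the Leibniz rule yields the symmetry.\<close>

lemma mixed_partials_eq:
  assumes op: "open \<Omega>" and z: "z \<in> \<Omega>"
    and df: "\<And>z. z \<in> \<Omega> \<Longrightarrow> f differentiable (at z)"
    and d2: "\<And>z. z \<in> \<Omega> \<Longrightarrow> pd2 f differentiable (at z)"
    and c: "continuous_on \<Omega> (pd1 (pd2 f))"
    and d1: "\<And>z. z \<in> \<Omega> \<Longrightarrow> pd1 f differentiable (at z)"
  shows "pd2 (pd1 f) z = pd1 (pd2 f) z"
proof -
  obtain a b c' e where sub: "cbox (a, c') (b, e) \<subseteq> \<Omega>" and zb: "z \<in> box (a, c') (b, e)"
    using open_contains_nondegenerate_cbox[OF op z] .
  have sub': "{a..b} \<times> {c'..e} \<subseteq> \<Omega>" using sub by (simp add: cbox_Pair_eq)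
  obtain x y where zxy: "z = (x, y)" by fastforce
  have x: "x \<in> {a<..<b}" and y: "y \<in> {c'<..<e}" using zb zxy by (auto simp: mem_box_Pair)
  have Q: "continuous_on ({a..b} \<times> {c'..e}) (pd2 f)"
    using sub' d2 by (meson continuous_at_imp_continuous_on differentiable_imp_continuous_within subsetD)
  have Q1: "continuous_on ({a..b} \<times> {c'..e}) (pd1 (pd2 f))" using c sub' continuous_on_subset by blast
  have key: "pd1 f (x, u) = pd1 f (x, c') + integral {c'..u} (\<lambda>t. pd1 (pd2 f) (x, t))"
    if u: "u \<in> {c'<..<e}" for u
  proof -
    have ft: "f (s, u) - f (s, c') = integral {c'..u} (\<lambda>t. pd2 f (s, t))" if "s \<in> {a<..<b}" for s
    proof -
      have "((\<lambda>t. pd2 f (s, t)) has_integral (f (s, u) - f (s, c'))) {c'..u}"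
      proof (rule fundamental_theorem_of_calculus)
        show "((\<lambda>t. f (s, t)) has_vector_derivative pd2 f (s, t)) (at t within {c'..u})"
          if "t \<in> {c'..u}" for t
        proof -
          have "(s, t) \<in> \<Omega>" using that sub' u \<open>s \<in> {a<..<b}\<close> by auto
          from has_real_derivative_pd(2)[OF df[OF this]] show ?thesis
            using has_field_derivative_at_within has_real_derivative_iff_has_vector_derivative by blast
        qed
      qed (use u in auto)
      then show ?thesis by (simp add: integral_unique)
    qed
    have "((\<lambda>s. f (s, u) - f (s, c')) has_real_derivative pd1 f (x, u) - pd1 f (x, c')) (at x)"
    proof -
      have "(x, u) \<in> \<Omega>" "(x, c') \<in> \<Omega>" using sub' u x by auto
      then show ?thesis by (intro DERIV_diff has_real_derivative_pd df)
    qed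
    moreover have "((\<lambda>s. f (s, u) - f (s, c')) has_real_derivative integral {c'..u} (\<lambda>t. pd1 (pd2 f) (x, t))) (at x)"
    proof (rule has_field_derivative_transform_within_open[where S = "{a<..<b}"])
      show "((\<lambda>s. integral {c'..u} (\<lambda>t. pd2 f (s, t))) has_real_derivative integral {c'..u} (\<lambda>t. pd1 (pd2 f) (x, t))) (at x)"
      proof (rule integral_partial[OF x])
        show "((\<lambda>s. pd2 f (s, y')) has_real_derivative pd1 (pd2 f) (x, y')) (at x)"
          if "x \<in> {a<..<b}" "y' \<in> {c'..u}" for x y'
        proof -
          have "(x, y') \<in> \<Omega>" using that sub' u by auto
          then show ?thesis by (intro has_real_derivative_pd d2)
        qed
      qed (use u in \<open>auto intro!: continuous_on_subset[OF Q] continuous_on_subset[OF Q1]\<close>)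
    qed (use x ft in auto)
    ultimately show ?thesis using DERIV_unique by fastforce
  qed
  have "continuous_on {c'..e} (\<lambda>t. pd1 (pd2 f) (x, t))"
    by (rule continuous_on_section[OF Q1]) (use x in auto)
  from integral_has_real_derivative[OF this, of y]
  have "((\<lambda>u. integral {c'..u} (\<lambda>t. pd1 (pd2 f) (x, t))) has_real_derivative pd1 (pd2 f) (x, y)) (at y)"
    using y by (simp add: at_within_Icc_at)
  then have "((\<lambda>u. pd1 f (x, c') + integral {c'..u} (\<lambda>t. pd1 (pd2 f) (x, t))) has_real_derivative pd1 (pd2 f) (x, y)) (at y)"
    by (auto intro!: derivative_eq_intros)
  then have "((\<lambda>u. pd1 f (x, u)) has_real_derivative pd1 (pd2 f) (x, y)) (at y)"
    by (rule has_field_derivative_transform_within_open[where S = "{c'<..<e}"]) (use y key in auto)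
  moreover have "((\<lambda>u. pd1 f (x, u)) has_real_derivative pd2 (pd1 f) (x, y)) (at y)"
    using has_real_derivative_pd(2)[OF d1] z zxy by blast
  ultimately show ?thesis using DERIV_unique zxy by blast
qed

subsection \<open>Isothermal charts of minimal graphs\<close>

text \<open>\<open>CR\<close> makes the differential of \<open>k\<close> the complex multiple
  \<open>ky / Complex 0 b\<close> of the differential of \<open>Z\<close>, which is complex
  differentiability of \<open>k\<close> in the coordinate \<open>Z\<close>. Invariance of domain
  supplies the continuous inverse chart, and its derivative at the point is then the inverse
  matrix.\<close>

lemma holomorphic_in_chart:
  fixes Z k :: "real \<times> real \<Rightarrow> complex"
  assumes op: "open B" and z: "z \<in> B" and inj: "inj_on Z B" and cZ: "continuous_on B Z"
    and Z: "(Z has_derivative (\<lambda>v. fst v *\<^sub>R Complex 1 a + snd v *\<^sub>R Complex 0 b)) (at z)"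
    and b: "b \<noteq> 0"
    and k: "(k has_derivative (\<lambda>v. fst v *\<^sub>R kx + snd v *\<^sub>R ky)) (at z)"
    and CR: "kx * Complex 0 b = ky * Complex 1 a"
  shows "((\<lambda>w. k (inv_into B Z w)) has_field_derivative ky / Complex 0 b) (at (Z z))"
proof -
  define X where "X = inv_into B Z"
  have XZ: "X (Z y) = y" if "y \<in> B" for y
    using inj that by (simp add: X_def)
  have opZ: "open (Z ` B)"
    by (rule invariance_of_domain_gen[OF op cZ inj]) simp
  have cX: "continuous_on (Z ` B) X"
    by (rule continuous_on_inverse_open[OF op cZ]) (simp_all add: XZ)
  \<comment> \<open>The inverse of the real matrix with columns (1, a) and (0, b).\<close>
  define X' where "X' = (\<lambda>w. (Re w, (Im w - a * Re w) / b))"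
  have dX: "(X has_derivative X') (at (Z z))"
  proof (rule has_derivative_inverse_basic)
    show "(Z has_derivative (\<lambda>v. fst v *\<^sub>R Complex 1 a + snd v *\<^sub>R Complex 0 b)) (at (X (Z z)))"
      using Z z by (simp add: XZ)
    show "bounded_linear X'"
      unfolding X'_def divide_inverse
      by (intro bounded_linear_Pair bounded_linear_Re bounded_linear_compose[OF bounded_linear_mult_left]
          bounded_linear_sub bounded_linear_Im bounded_linear_compose[OF bounded_linear_mult_right])
    show "X' \<circ> (\<lambda>v. fst v *\<^sub>R Complex 1 a + snd v *\<^sub>R Complex 0 b) = id"
      using b by (auto simp: X'_def fun_eq_iff prod_eq_iff)
    show "continuous (at (Z z)) X"
      using cX opZ z continuous_on_eq_continuous_at by blast
    show "Z (X w) = w" if "w \<in> Z ` B" for w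
      using that XZ by auto
  qed (use z opZ in auto)
  have "(k has_derivative (\<lambda>v. fst v *\<^sub>R kx + snd v *\<^sub>R ky)) (at (X (Z z)))"
    using k z by (simp add: XZ)
  from diff_chain_at[OF dX this]
  have "((\<lambda>w. k (X w)) has_derivative (\<lambda>w. fst (X' w) *\<^sub>R kx + snd (X' w) *\<^sub>R ky)) (at (Z z))"
    by (simp add: o_def)
  moreover have "fst (X' w) *\<^sub>R kx + snd (X' w) *\<^sub>R ky = ky / Complex 0 b * w" for w
  proof -
    have b0: "Complex 0 b \<noteq> 0" using b by (simp add: complex_eq_iff)
    have kx: "kx = ky * Complex 1 a / Complex 0 b" using CR b0 by (simp add: field_simps)
    have ky: "ky = ky * Complex 0 b / Complex 0 b" using b0 by simp
    have "fst (X' w) *\<^sub>R kx + snd (X' w) *\<^sub>R ky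
       = (fst (X' w) *\<^sub>R Complex 1 a + snd (X' w) *\<^sub>R Complex 0 b) * (ky / Complex 0 b)"
      by (subst kx, subst (2) ky) (simp add: algebra_simps scaleR_conv_of_real)
    also have "fst (X' w) *\<^sub>R Complex 1 a + snd (X' w) *\<^sub>R Complex 0 b = w"
      using b by (simp add: X'_def complex_eq_iff)
    finally show ?thesis by simp
  qed
  then have "(\<lambda>w. fst (X' w) *\<^sub>R kx + snd (X' w) *\<^sub>R ky) = (*) (ky / Complex 0 b)"
    by (rule ext)
  ultimately show ?thesis unfolding has_field_derivative_def X_def by (simp only:)
qed

lemma has_derivative_quotient:
  fixes u w :: "real \<times> real \<Rightarrow> real"
  assumes "(u has_derivative (\<lambda>v. fst v * ux + snd v * uy)) (at z)"
    "(w has_derivative (\<lambda>v. fst v * wx + snd v * wy)) (at z)" "w z \<noteq> 0"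
  shows "((\<lambda>z. u z / w z) has_derivative
     (\<lambda>v. fst v * ((ux * w z - u z * wx) / (w z)\<^sup>2) + snd v * ((uy * w z - u z * wy) / (w z)\<^sup>2))) (at z)"
  using assms by (auto intro!: derivative_eq_intros simp: fun_eq_iff divide_simps power2_eq_square)
     (auto simp: algebra_simps)

lemma has_derivative_Complex:
  assumes "(u has_derivative (\<lambda>v. fst v * a + snd v * b)) (at z)"
    "(w has_derivative (\<lambda>v. fst v * c + snd v * d)) (at z)"
  shows "((\<lambda>z. Complex (u z) (w z)) has_derivative (\<lambda>v. fst v *\<^sub>R Complex a c + snd v *\<^sub>R Complex b d)) (at z)"
proof -
  have "((\<lambda>z. of_real (u z) + \<i> * of_real (w z)) has_derivative
    (\<lambda>v. of_real (fst v * a + snd v * b) + \<i> * of_real (fst v * c + snd v * d))) (at z)"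
    using assms by (auto intro!: derivative_eq_intros)
  moreover have "(\<lambda>v. of_real (fst v * a + snd v * b) + \<i> * of_real (fst v * c + snd v * d))
     = (\<lambda>v::real\<times>real. fst v *\<^sub>R Complex a c + snd v *\<^sub>R Complex b d)"
    by (auto simp: fun_eq_iff complex_eq_iff)
  moreover have "(\<lambda>z. of_real (u z) + \<i> * of_real (w z)) = (\<lambda>z. Complex (u z) (w z))"
    by (auto simp: fun_eq_iff complex_eq_iff)
  ultimately show ?thesis by simp
qed

section \<open>Minimal graphs in Monge's notation\<close>

locale minimal_graph =
  fixes \<Omega> :: "(real \<times> real) set" and \<omega> :: "real \<times> real \<Rightarrow> real"
  assumes op: "open \<Omega>" and C2: "C2_on \<Omega> \<omega>" and mse: "minimal_surface_eq \<Omega> \<omega>"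
begin

definition "p = pd1 \<omega>"
definition "q = pd2 \<omega>"
definition "r = pd1 (pd1 \<omega>)"
definition "s = pd2 (pd1 \<omega>)"
definition "t = pd2 (pd2 \<omega>)"
definition "W z = sqrt (1 + (p z)\<^sup>2 + (q z)\<^sup>2)"

lemma W_gt0: "W z > 0" and W_ge1: "W z \<ge> 1" and W_sq: "(W z)\<^sup>2 = 1 + (p z)\<^sup>2 + (q z)\<^sup>2"
proof -
  have "1 + (p z)\<^sup>2 + (q z)\<^sup>2 \<ge> 1" by simp
  then show "W z \<ge> 1" "W z > 0" unfolding W_def by (simp_all add: add_pos_nonneg)
  show "(W z)\<^sup>2 = 1 + (p z)\<^sup>2 + (q z)\<^sup>2" unfolding W_def by simp
qed

lemma W_nz [simp]: "W z \<noteq> 0" "1 + W z \<noteq> 0"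
  using W_gt0[of z] by auto

lemma has_derivative_\<omega>: "z \<in> \<Omega> \<Longrightarrow> (\<omega> has_derivative (\<lambda>v. fst v * p z + snd v * q z)) (at z)"
  unfolding p_def q_def using C2 by (intro differentiable_has_derivative_pd) (simp add: C2_on_def)

lemma has_derivative_p: "z \<in> \<Omega> \<Longrightarrow> (p has_derivative (\<lambda>v. fst v * r z + snd v * s z)) (at z)"
  unfolding p_def r_def s_def using C2 by (intro differentiable_has_derivative_pd) (simp add: C2_on_def)

lemma has_derivative_q: 
  assumes "z \<in> \<Omega>"
  shows "(q has_derivative (\<lambda>v. fst v * s z + snd v * t z)) (at z)"
proof -
  have "pd2 (pd1 \<omega>) z = pd1 (pd2 \<omega>) z"
    by (rule mixed_partials_eq[OF op assms]) (use C2 in \<open>auto simp: C2_on_def\<close>)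
  then show ?thesis
    using C2 differentiable_has_derivative_pd[of "pd2 \<omega>" z] assms
    unfolding q_def s_def t_def by (simp add: C2_on_def)
qed

lemma has_derivative_W:
  assumes "z \<in> \<Omega>"
  shows "(W has_derivative (\<lambda>v. fst v * ((p z * r z + q z * s z) / W z)
            + snd v * ((p z * s z + q z * t z) / W z))) (at z)"
proof -
  have "1 + (p z)\<^sup>2 + (q z)\<^sup>2 > 0" by (simp add: add_pos_nonneg)
  then show ?thesis unfolding W_def
    by (auto intro!: derivative_eq_intros has_derivative_p has_derivative_q assms
        simp: fun_eq_iff divide_simps) (auto simp: algebra_simps)
qed

lemma cont_second:
  "continuous_on \<Omega> \<omega>" "continuous_on \<Omega> p" "continuous_on \<Omega> q" "continuous_on \<Omega> r" "continuous_on \<Omega> s"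
  "continuous_on \<Omega> t" "continuous_on \<Omega> W"
proof -
  show "continuous_on \<Omega> \<omega>" "continuous_on \<Omega> p" "continuous_on \<Omega> q" "continuous_on \<Omega> W"
    using has_derivative_p has_derivative_q has_derivative_W has_derivative_\<omega> has_derivative_continuous
    by (blast intro: continuous_at_imp_continuous_on)+
  show "continuous_on \<Omega> r" "continuous_on \<Omega> s" "continuous_on \<Omega> t"
    using C2 unfolding r_def s_def t_def C2_on_def by auto
qed

text \<open>The divergence form multiplied by W^3. Together with \<open>W_sq\<close> it turns the
  closedness of the conjugate abscissa and the Cauchy-Riemann equations of the Gauss map into
  polynomial identities.\<close>

lemma mse_expanded:
  assumes "z \<in> \<Omega>"
  shows "(1 + (q z)\<^sup>2) * r z - 2 * p z * q z * s z + (1 + (p z)\<^sup>2) * t z = 0"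
proof -
  note d = has_derivative_p[OF assms] has_derivative_q[OF assms] has_derivative_W[OF assms]
  have m: "pd1 (\<lambda>z. p z / W z) z + pd2 (\<lambda>z. q z / W z) z = 0"
    using mse assms unfolding minimal_surface_eq_def W_def p_def q_def by blast
  have "(r z * W z - p z * ((p z * r z + q z * s z) / W z)) / (W z)\<^sup>2 +
     (t z * W z - q z * ((p z * s z + q z * t z) / W z)) / (W z)\<^sup>2 = 0"
    using m has_derivative_pd_eq[OF has_derivative_quotient[OF d(1,3) W_nz(1)]]
      has_derivative_pd_eq[OF has_derivative_quotient[OF d(2,3) W_nz(1)]] by simp
  then have "r z * (W z)\<^sup>2 - p z * (p z * r z + q z * s z) + t z * (W z)\<^sup>2 - q z * (p z * s z + q z * t z) = 0"
    using W_nz(1)[of z] by (simp add: divide_simps power2_eq_square)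
  then show ?thesis unfolding W_sq by (simp add: algebra_simps power2_eq_square)
qed

text \<open>The form is the Hodge star of d\<omega> for the induced metric, and its closedness is
  literally the minimal surface equation in divergence form.\<close>

lemma conjugate_height:
  assumes "cbox (a, c) (b, e) \<subseteq> \<Omega>"
  shows "\<exists>H. \<forall>z\<in>box (a, c) (b, e). (H has_derivative (\<lambda>v. fst v * (- q z / W z) + snd v * (p z / W z))) (at z)"
proof (rule closed_form_primitive_box[OF assms op])
  have mq: "((\<lambda>z. - q z) has_derivative (\<lambda>v. fst v * (- s z) + snd v * (- t z))) (at z)" if "z \<in> \<Omega>" for z
    using has_derivative_minus[OF has_derivative_q[OF that]] by simp
  note D = has_derivative_quotient[OF mq has_derivative_W W_nz(1)]
    has_derivative_quotient[OF has_derivative_p has_derivative_W W_nz(1)]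
  fix z assume z: "z \<in> \<Omega>"
  show "(\<lambda>z. - q z / W z) differentiable at z" "(\<lambda>z. p z / W z) differentiable at z"
    using D(1)[OF z z] D(2)[OF z z] unfolding differentiable_def by blast+
  have "pd2 (\<lambda>z. - q z / W z) z = - pd2 (\<lambda>z. q z / W z) z"
    unfolding has_derivative_pd_eq[OF D(1)[OF z z]]
      has_derivative_pd_eq[OF has_derivative_quotient[OF has_derivative_q[OF z] has_derivative_W[OF z] W_nz(1)]]
    by (simp add: field_simps)
  moreover have "pd1 (\<lambda>z. p z / W z) z + pd2 (\<lambda>z. q z / W z) z = 0"
    using mse z unfolding minimal_surface_eq_def W_def p_def q_def by blast
  ultimately show "pd1 (\<lambda>z. p z / W z) z = pd2 (\<lambda>z. - q z / W z) z" by simp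
next
  have "continuous_on \<Omega> (\<lambda>z. (r z * W z - p z * ((p z * r z + q z * s z) / W z)) / (W z)\<^sup>2)"
    by (intro continuous_intros cont_second) simp_all
  then show "continuous_on \<Omega> (pd1 (\<lambda>z. p z / W z))"
    by (rule continuous_on_eq)
      (simp add: has_derivative_pd_eq[OF has_derivative_quotient[OF has_derivative_p has_derivative_W W_nz(1)]])
qed

text \<open>The form is the Hodge star of dx for the induced metric; it is closed because the
  coordinate x is harmonic on a minimal surface.\<close>

lemma conjugate_abscissa:
  assumes "cbox (a, c) (b, e) \<subseteq> \<Omega>"
  shows "\<exists>Y. \<forall>z\<in>box (a, c) (b, e).
    (Y has_derivative (\<lambda>v. fst v * (p z * q z / W z) + snd v * ((1 + (q z)\<^sup>2) / W z))) (at z)"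
proof (rule closed_form_primitive_box[OF assms op])
  have pq: "((\<lambda>z. p z * q z) has_derivative
      (\<lambda>v. fst v * (r z * q z + p z * s z) + snd v * (s z * q z + p z * t z))) (at z)"
    if "z \<in> \<Omega>" for z
    by (rule derivative_eq_intros has_derivative_p has_derivative_q that refl)+
      (auto simp: fun_eq_iff algebra_simps)
  have qq: "((\<lambda>z. 1 + (q z)\<^sup>2) has_derivative
      (\<lambda>v. fst v * (2 * q z * s z) + snd v * (2 * q z * t z))) (at z)"
    if "z \<in> \<Omega>" for z
    by (rule derivative_eq_intros has_derivative_p has_derivative_q that refl)+
      (auto simp: fun_eq_iff algebra_simps)
  note D = has_derivative_quotient[OF pq has_derivative_W W_nz(1)]
    has_derivative_quotient[OF qq has_derivative_W W_nz(1)]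
  {
    fix z assume z: "z \<in> \<Omega>"
    show "(\<lambda>z. p z * q z / W z) differentiable at z" "(\<lambda>z. (1 + (q z)\<^sup>2) / W z) differentiable at z"
      using D(1)[OF z z] D(2)[OF z z] unfolding differentiable_def by blast+
    \<comment> \<open>The two sides differ by - p times the left-hand side of
      \<open>mse_expanded\<close>.\<close>
    have "2 * q z * s z * (W z)\<^sup>2 - (1 + (q z)\<^sup>2) * (p z * r z + q z * s z) =
      (s z * q z + p z * t z) * (W z)\<^sup>2 - p z * q z * (p z * s z + q z * t z)"
      using mse_expanded[OF z] W_sq[of z] by algebra
    then show "pd1 (\<lambda>z. (1 + (q z)\<^sup>2) / W z) z = pd2 (\<lambda>z. p z * q z / W z) z"
      unfolding has_derivative_pd_eq[OF D(1)[OF z z]] has_derivative_pd_eq[OF D(2)[OF z z]]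
      by (simp add: divide_simps) (simp add: algebra_simps power2_eq_square)
  }
  have "continuous_on \<Omega> (\<lambda>z. (2 * q z * s z * W z - (1 + (q z)\<^sup>2) * ((p z * r z + q z * s z) / W z)) / (W z)\<^sup>2)"
    by (intro continuous_intros cont_second) simp_all
  then show "continuous_on \<Omega> (pd1 (\<lambda>z. (1 + (q z)\<^sup>2) / W z))"
    by (rule continuous_on_eq) (simp add: has_derivative_pd_eq[OF D(2)])
qed

text \<open>The Gauss map read in the lower stereographic projection; orientation chosen to make it
  holomorphic in the chart whose real part is the first coordinate.\<close>
definition "gauss_map z = Complex (p z / (1 + W z)) (- q z / (1 + W z))"

lemma norm_gauss_map: "(norm (gauss_map z))\<^sup>2 = ((p z)\<^sup>2 + (q z)\<^sup>2) / (1 + W z)\<^sup>2"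
  by (simp add: gauss_map_def cmod_power2 power_divide add_divide_distrib)

text \<open>The second conclusion is the hypothesis \<open>CR\<close> of
  \<open>holomorphic_in_chart\<close>. The third is a quotient of Jacobians: (s^2 - r t) / (W (1 +
  W)^2) for the Gauss map in the plane, divided by (1 + q^2) / W for the chart.\<close>

lemma gauss_map_derivative:
  assumes z: "z \<in> \<Omega>"
  obtains gx gy where
    "(gauss_map has_derivative (\<lambda>v. fst v *\<^sub>R gx + snd v *\<^sub>R gy)) (at z)"
    "gx * Complex 0 ((1 + (q z)\<^sup>2) / W z) = gy * Complex 1 (p z * q z / W z)"
    "(norm (gy / Complex 0 ((1 + (q z)\<^sup>2) / W z)))\<^sup>2
        = ((s z)\<^sup>2 - r z * t z) / ((1 + (q z)\<^sup>2) * (1 + W z)\<^sup>2)"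
proof -
  have mq: "((\<lambda>z. - q z) has_derivative (\<lambda>v. fst v * (- s z) + snd v * (- t z))) (at z)"
    using has_derivative_minus[OF has_derivative_q[OF z]] by simp
  let ?Wx = "(p z * r z + q z * s z) / W z" and ?Wy = "(p z * s z + q z * t z) / W z"
  have W1: "((\<lambda>z. 1 + W z) has_derivative (\<lambda>v. fst v * ?Wx + snd v * ?Wy)) (at z)"
    using has_derivative_add[OF has_derivative_const has_derivative_W[OF z]] by simp
  define ux uy vx vy where
    "ux = (r z * (1 + W z) - p z * ?Wx) / (1 + W z)\<^sup>2" and
    "uy = (s z * (1 + W z) - p z * ?Wy) / (1 + W z)\<^sup>2" and
    "vx = (- s z * (1 + W z) - (- q z) * ?Wx) / (1 + W z)\<^sup>2" and
    "vy = (- t z * (1 + W z) - (- q z) * ?Wy) / (1 + W z)\<^sup>2"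
  define Ux Uy Vx Vy where
    "Ux = r z * W z * (1 + W z) - p z * (p z * r z + q z * s z)" and
    "Uy = s z * W z * (1 + W z) - p z * (p z * s z + q z * t z)" and
    "Vx = - s z * W z * (1 + W z) + q z * (p z * r z + q z * s z)" and
    "Vy = - t z * W z * (1 + W z) + q z * (p z * s z + q z * t z)"
  define N where "N = W z * (1 + W z)\<^sup>2"
  have N: "N \<noteq> 0" by (simp add: N_def)
  have u: "ux = Ux / N" "uy = Uy / N" "vx = Vx / N" "vy = Vy / N"
    unfolding ux_def uy_def vx_def vy_def Ux_def Uy_def Vx_def Vy_def N_def
    by (simp_all add: divide_simps)
  note M = mse_expanded[OF z] W_sq[of z]
  \<comment> \<open>\<open>C1\<close> and \<open>C2\<close> are the real and imaginary parts of the
    Cauchy-Riemann condition after the common denominator \<open>N\<close> is cleared;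
    \<open>J\<close> is the Jacobian of the numerators.\<close>
  have C1: "- Vx * (1 + (q z)\<^sup>2) = W z * Uy - p z * q z * Vy"
    using M unfolding Ux_def Uy_def Vx_def Vy_def by algebra
  have C2: "Ux * (1 + (q z)\<^sup>2) = W z * Vy + p z * q z * Uy"
    using M unfolding Ux_def Uy_def Vx_def Vy_def by algebra
  have J: "Ux * Vy - Vx * Uy = ((s z)\<^sup>2 - r z * t z) * W z * (1 + W z)\<^sup>2"
    using M(2) unfolding Ux_def Uy_def Vx_def Vy_def by algebra
  have q1: "1 + (q z)\<^sup>2 > 0" by (simp add: add_pos_nonneg)
  have "(gauss_map has_derivative (\<lambda>v. fst v *\<^sub>R Complex ux vx + snd v *\<^sub>R Complex uy vy)) (at z)"
    unfolding gauss_map_def ux_def uy_def vx_def vy_def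
    by (intro has_derivative_Complex has_derivative_quotient W1 mq has_derivative_p[OF z] W_nz)
  moreover have "Complex ux vx * Complex 0 ((1 + (q z)\<^sup>2) / W z) = Complex uy vy * Complex 1 (p z * q z / W z)"
    using C1 C2 N W_nz(1)[of z] unfolding u
    by (simp add: complex_eq_iff divide_simps)
  moreover have "(norm (Complex uy vy / Complex 0 ((1 + (q z)\<^sup>2) / W z)))\<^sup>2
        = ((s z)\<^sup>2 - r z * t z) / ((1 + (q z)\<^sup>2) * (1 + W z)\<^sup>2)"
  proof -
    have "W z * (Uy\<^sup>2 + Vy\<^sup>2) = (1 + (q z)\<^sup>2) * (Ux * Vy - Vx * Uy)"
      using C1 C2 by algebra
    then have E: "Uy\<^sup>2 + Vy\<^sup>2 = (1 + (q z)\<^sup>2) * ((s z)\<^sup>2 - r z * t z) * (1 + W z)\<^sup>2"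
      unfolding J using W_nz(1)[of z] by simp
    have n: "norm (Complex 0 ((1 + (q z)\<^sup>2) / W z)) = (1 + (q z)\<^sup>2) / W z"
      using q1 W_gt0[of z] by (simp add: complex_norm)
    have "(norm (Complex uy vy / Complex 0 ((1 + (q z)\<^sup>2) / W z)))\<^sup>2
       = ((Uy\<^sup>2 + Vy\<^sup>2) / N\<^sup>2) * (W z)\<^sup>2 / (1 + (q z)\<^sup>2)\<^sup>2"
      unfolding norm_divide n power_divide u by (simp add: cmod_power2 power_divide add_divide_distrib)
    also have "\<dots> = ((s z)\<^sup>2 - r z * t z) / ((1 + (q z)\<^sup>2) * (1 + W z)\<^sup>2)"
      unfolding E N_def using q1 by (simp add: divide_simps power2_eq_square)
    finally show ?thesis .
  qed
  ultimately show ?thesis by (rule that)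
qed

text \<open>The chart inverts Z = x + i Y with Y the conjugate of x. Derivatives enter only through
  squared norms expressed in p, q, r, s, t; the factor 1 + q^2, which comes from choosing x as real
  part, cancels in the quotient of the two.\<close>

lemma isothermal_chart:
  assumes z0: "z0 \<in> \<Omega>"
  obtains X f g \<zeta>0 \<epsilon> where "\<epsilon> > 0" "X \<zeta>0 = z0" "continuous_on (ball \<zeta>0 \<epsilon>) X" "inj_on X (ball \<zeta>0 \<epsilon>)"
    "X ` ball \<zeta>0 \<epsilon> \<subseteq> \<Omega>" "f holomorphic_on ball \<zeta>0 \<epsilon>" "g holomorphic_on ball \<zeta>0 \<epsilon>"
    "\<And>\<zeta>. \<zeta> \<in> ball \<zeta>0 \<epsilon> \<Longrightarrow> Re (f \<zeta>) = \<omega> (X \<zeta>)"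
    "\<And>\<zeta>. \<zeta> \<in> ball \<zeta>0 \<epsilon> \<Longrightarrow>
       (norm (deriv f \<zeta>))\<^sup>2 = ((p (X \<zeta>))\<^sup>2 + (q (X \<zeta>))\<^sup>2) / (1 + (q (X \<zeta>))\<^sup>2)"
    "\<And>\<zeta>. \<zeta> \<in> ball \<zeta>0 \<epsilon> \<Longrightarrow> (norm (g \<zeta>))\<^sup>2 = ((p (X \<zeta>))\<^sup>2 + (q (X \<zeta>))\<^sup>2) / (1 + W (X \<zeta>))\<^sup>2"
    "\<And>\<zeta>. \<zeta> \<in> ball \<zeta>0 \<epsilon> \<Longrightarrow>
       (norm (deriv g \<zeta>))\<^sup>2 = ((s (X \<zeta>))\<^sup>2 - r (X \<zeta>) * t (X \<zeta>)) / ((1 + (q (X \<zeta>))\<^sup>2) * (1 + W (X \<zeta>))\<^sup>2)"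
proof -
  obtain a b c e where sub: "cbox (a, c) (b, e) \<subseteq> \<Omega>" and zb: "z0 \<in> box (a, c) (b, e)"
    using open_contains_nondegenerate_cbox[OF op z0] .
  let ?B = "box (a, c) (b, e)"
  have sub': "?B \<subseteq> \<Omega>" using sub box_subset_cbox by blast
  obtain H where H: "\<And>z. z \<in> ?B \<Longrightarrow> (H has_derivative (\<lambda>v. fst v * (- q z / W z) + snd v * (p z / W z))) (at z)"
    using conjugate_height[OF sub] by blast
  obtain Y where Y: "\<And>z. z \<in> ?B \<Longrightarrow>
    (Y has_derivative (\<lambda>v. fst v * (p z * q z / W z) + snd v * ((1 + (q z)\<^sup>2) / W z))) (at z)"
    using conjugate_abscissa[OF sub] by blast
  have b_pos: "(1 + (q z)\<^sup>2) / W z > 0" for z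
    using W_gt0[of z] by (simp add: add_pos_nonneg)
  define Z where "Z = (\<lambda>z. Complex (fst z) (Y z))"
  have dZ: "(Z has_derivative (\<lambda>v. fst v *\<^sub>R Complex 1 (p z * q z / W z)
      + snd v *\<^sub>R Complex 0 ((1 + (q z)\<^sup>2) / W z))) (at z)" if "z \<in> ?B" for z
    unfolding Z_def by (intro has_derivative_Complex Y that) (auto intro!: derivative_eq_intros)
  have cZ: "continuous_on ?B Z"
    using dZ has_derivative_continuous continuous_at_imp_continuous_on by blast
  \<comment> \<open>Points with the same image have the same first coordinate, and \<open>Y\<close>
    is strictly increasing along vertical segments, which stay inside the box.\<close>
  have inj: "inj_on Z ?B"
  proof (rule inj_onI)
    have mono: "Y (x, y1) < Y (x, y2)" if "(x, y1) \<in> ?B" "(x, y2) \<in> ?B" "y1 < y2" for x y1 y2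
    proof (rule DERIV_pos_imp_increasing[OF \<open>y1 < y2\<close>])
      fix y assume y: "y1 \<le> y" "y \<le> y2"
      then have m: "(x, y) \<in> ?B" using that by (auto simp: mem_box_Pair)
      have "((\<lambda>t. Y (x, t)) has_vector_derivative ((1 + (q (x, y))\<^sup>2) / W (x, y))) (at y)"
        by (rule has_derivative_sections(2)[where a = "p (x, y) * q (x, y) / W (x, y)"])
          (use Y[OF m] in simp)
      then show "\<exists>d. ((\<lambda>t. Y (x, t)) has_real_derivative d) (at y) \<and> 0 < d"
        using b_pos by (auto simp: has_real_derivative_iff_has_vector_derivative)
    qed
    fix z w assume zw: "z \<in> ?B" "w \<in> ?B" "Z z = Z w"
    obtain x y1 y2 where "z = (x, y1)" "w = (x, y2)"
      using zw(3) by (cases z, cases w) (auto simp: Z_def)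
    with zw mono[of x y1 y2] mono[of x y2 y1] show "z = w"
      by (cases y1 y2 rule: linorder_cases) (auto simp: Z_def)
  qed
  define X where "X = inv_into ?B Z"
  have opB: "open ?B" by (rule open_box)
  have opZ: "open (Z ` ?B)"
    by (rule invariance_of_domain_gen[OF opB cZ inj]) simp
  have XZ: "X (Z y) = y" if "y \<in> ?B" for y
    using inj that by (simp add: X_def)
  have cX: "continuous_on (Z ` ?B) X"
    by (rule continuous_on_inverse_open[OF opB cZ]) (simp_all add: XZ)
  obtain \<epsilon> where e: "\<epsilon> > 0" "ball (Z z0) \<epsilon> \<subseteq> Z ` ?B"
    using openE[OF opZ, of "Z z0"] zb by blast
  have XB: "X \<zeta> \<in> ?B" and ZX: "Z (X \<zeta>) = \<zeta>" if \<zeta>: "\<zeta> \<in> ball (Z z0) \<epsilon>" for \<zeta>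
  proof -
    obtain y where "y \<in> ?B" "\<zeta> = Z y" using e(2) \<zeta> by blast
    then show "X \<zeta> \<in> ?B" "Z (X \<zeta>) = \<zeta>" using XZ by simp_all
  qed
  define f where "f = (\<lambda>\<zeta>. Complex (\<omega> (X \<zeta>)) (H (X \<zeta>)))"
  define g where "g = (\<lambda>\<zeta>. gauss_map (X \<zeta>))"
  have df: "(f has_field_derivative Complex (q z) (p z / W z) / Complex 0 ((1 + (q z)\<^sup>2) / W z)) (at \<zeta>)"
    if "\<zeta> \<in> ball (Z z0) \<epsilon>" "z = X \<zeta>" for \<zeta> z
  proof -
    have z: "z \<in> ?B" "Z z = \<zeta>" using that XB ZX by auto
    have "((\<lambda>w. (\<lambda>z. Complex (\<omega> z) (H z)) (inv_into ?B Z w)) has_field_derivative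
        Complex (q z) (p z / W z) / Complex 0 ((1 + (q z)\<^sup>2) / W z)) (at (Z z))"
    proof (rule holomorphic_in_chart[OF opB z(1) inj cZ dZ[OF z(1)]])
      show "((\<lambda>z. Complex (\<omega> z) (H z)) has_derivative
         (\<lambda>v. fst v *\<^sub>R Complex (p z) (- q z / W z) + snd v *\<^sub>R Complex (q z) (p z / W z))) (at z)"
        using z sub' by (intro has_derivative_Complex H has_derivative_\<omega>) auto
      show "Complex (p z) (- q z / W z) * Complex 0 ((1 + (q z)\<^sup>2) / W z) =
          Complex (q z) (p z / W z) * Complex 1 (p z * q z / W z)"
        using W_sq[of z] by (simp add: complex_eq_iff divide_simps) algebra
    qed (use b_pos[of z] in linarith)
    then show ?thesis unfolding f_def X_def[symmetric] z(2) .
  qed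
  have dg: "\<exists>D. (g has_field_derivative D) (at \<zeta>) \<and>
      (norm D)\<^sup>2 = ((s (X \<zeta>))\<^sup>2 - r (X \<zeta>) * t (X \<zeta>)) / ((1 + (q (X \<zeta>))\<^sup>2) * (1 + W (X \<zeta>))\<^sup>2)"
    if "\<zeta> \<in> ball (Z z0) \<epsilon>" for \<zeta>
  proof -
    define z where "z = X \<zeta>"
    have z: "z \<in> ?B" "Z z = \<zeta>" using that XB ZX z_def by auto
    then have "z \<in> \<Omega>" using sub' by auto
    obtain gx gy where
     *: "(gauss_map has_derivative (\<lambda>v. fst v *\<^sub>R gx + snd v *\<^sub>R gy)) (at z)"
      "gx * Complex 0 ((1 + (q z)\<^sup>2) / W z) = gy * Complex 1 (p z * q z / W z)" and
      n: "(norm (gy / Complex 0 ((1 + (q z)\<^sup>2) / W z)))\<^sup>2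
        = ((s z)\<^sup>2 - r z * t z) / ((1 + (q z)\<^sup>2) * (1 + W z)\<^sup>2)"
      by (rule gauss_map_derivative[OF \<open>z \<in> \<Omega>\<close>])
    have "(1 + (q z)\<^sup>2) / W z \<noteq> 0" using b_pos[of z] by linarith
    from holomorphic_in_chart[OF opB z(1) inj cZ dZ[OF z(1)] this *]
    have "(g has_field_derivative gy / Complex 0 ((1 + (q z)\<^sup>2) / W z)) (at \<zeta>)"
      unfolding g_def X_def[symmetric] z(2) .
    with n show ?thesis unfolding z_def by blast
  qed
  show ?thesis
  proof (rule that[of \<epsilon> X "Z z0" f g])
    show "continuous_on (ball (Z z0) \<epsilon>) X" using cX e(2) continuous_on_subset by blast
    show "inj_on X (ball (Z z0) \<epsilon>)" using ZX by (metis inj_onI)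
    show "X ` ball (Z z0) \<epsilon> \<subseteq> \<Omega>" using XB sub' by blast
    show "f holomorphic_on ball (Z z0) \<epsilon>" "g holomorphic_on ball (Z z0) \<epsilon>"
      using df dg by (meson holomorphic_on_open open_ball)+
    fix \<zeta> assume \<zeta>: "\<zeta> \<in> ball (Z z0) \<epsilon>"
    show "Re (f \<zeta>) = \<omega> (X \<zeta>)" by (simp add: f_def)
    let ?z = "X \<zeta>"
    have D: "deriv f \<zeta> = Complex (q ?z) (p ?z / W ?z) / Complex 0 ((1 + (q ?z)\<^sup>2) / W ?z)"
      using df[OF \<zeta> refl] DERIV_imp_deriv by blast
    have q1: "1 + (q ?z)\<^sup>2 > 0" by (simp add: add_pos_nonneg)
    have n: "norm (Complex 0 ((1 + (q ?z)\<^sup>2) / W ?z)) = (1 + (q ?z)\<^sup>2) / W ?z"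
      using q1 W_gt0[of ?z] by (simp add: complex_norm)
    have E: "(q ?z)\<^sup>2 * (W ?z)\<^sup>2 + (p ?z)\<^sup>2 = ((p ?z)\<^sup>2 + (q ?z)\<^sup>2) * (1 + (q ?z)\<^sup>2)"
      unfolding W_sq by algebra
    have "(norm (deriv f \<zeta>))\<^sup>2 = ((q ?z)\<^sup>2 + (p ?z)\<^sup>2 / (W ?z)\<^sup>2) * (W ?z)\<^sup>2 / (1 + (q ?z)\<^sup>2)\<^sup>2"
      unfolding D norm_divide n power_divide by (simp add: cmod_power2 power_divide)
    also have "((q ?z)\<^sup>2 + (p ?z)\<^sup>2 / (W ?z)\<^sup>2) * (W ?z)\<^sup>2 = (q ?z)\<^sup>2 * (W ?z)\<^sup>2 + (p ?z)\<^sup>2"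
      by (simp add: distrib_right)
    finally show "(norm (deriv f \<zeta>))\<^sup>2 = ((p ?z)\<^sup>2 + (q ?z)\<^sup>2) / (1 + (q ?z)\<^sup>2)"
      unfolding E using q1 by (simp add: power2_eq_square)
    show "(norm (g \<zeta>))\<^sup>2 = ((p ?z)\<^sup>2 + (q ?z)\<^sup>2) / (1 + W ?z)\<^sup>2"
      by (simp add: g_def norm_gauss_map)
    show "(norm (deriv g \<zeta>))\<^sup>2 = ((s ?z)\<^sup>2 - r ?z * t ?z) / ((1 + (q ?z)\<^sup>2) * (1 + W ?z)\<^sup>2)"
      using dg[OF \<zeta>] DERIV_imp_deriv by blast
  qed (use e XZ zb in auto)
qed

end

subsection \<open>Local form of the Schwarz--Ahlfors lemma for the strip\<close>

lemma second_derivative_nonpos_at_max: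
  fixes U V :: "real \<Rightarrow> real"
  assumes d: "\<delta> > 0" and U: "\<And>x. \<bar>x\<bar> < \<delta> \<Longrightarrow> (U has_real_derivative V x) (at x)"
    and V: "(V has_real_derivative D) (at 0)" and max: "\<And>x. \<bar>x\<bar> < \<delta> \<Longrightarrow> U x \<le> U 0"
  shows "D \<le> 0"
proof (rule ccontr)
  assume "\<not> D \<le> 0"
  then obtain h where h: "h > 0" "\<And>x. 0 < x \<Longrightarrow> x < h \<Longrightarrow> V 0 < V (0 + x)"
    using DERIV_pos_inc_right[OF V] by (metis not_le)
  have V0: "V 0 = 0"
    using DERIV_local_max[OF U[of 0] d] max d by simp
  define c where "c = min h \<delta> / 2"
  have c: "c > 0" "c < h" "c < \<delta>" using h d by (auto simp: c_def)
  have "U 0 < U c"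
  proof (rule DERIV_pos_imp_increasing_open[OF c(1)])
    fix x assume "0 < x" "x < c"
    then show "\<exists>y. (U has_real_derivative y) (at x) \<and> 0 < y"
      using U[of x] h(2)[of x] c V0 by auto
  next
    show "continuous_on {0..c} U"
      by (rule DERIV_atLeastAtMost_imp_continuous_on) (use U c in \<open>force intro: exI\<close>)
  qed
  with max[of c] c show False by auto
qed

text \<open>This is the restriction of the logarithm of the metric quotient to a line:
  \<open>l\<close> stands for log |g' / f'|, \<open>a\<close> and \<open>b\<close> for the real and
  imaginary parts of g, and \<phi> for Re f - m. The left-hand side is the second derivative at 0 of
  the function bounded in \<open>max\<close>.\<close>

lemma log_density_second_derivative:
  fixes l a b \<phi> l' a' b' \<phi>' :: "real \<Rightarrow> real"
  assumes d: "\<delta> > 0"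
    and D1: "\<And>x. \<bar>x\<bar> < \<delta> \<Longrightarrow> (l has_real_derivative l' x) (at x)"
      "\<And>x. \<bar>x\<bar> < \<delta> \<Longrightarrow> (a has_real_derivative a' x) (at x)"
      "\<And>x. \<bar>x\<bar> < \<delta> \<Longrightarrow> (b has_real_derivative b' x) (at x)"
      "\<And>x. \<bar>x\<bar> < \<delta> \<Longrightarrow> (\<phi> has_real_derivative \<phi>' x) (at x)"
    and D2: "(l' has_real_derivative l2) (at 0)" "(a' has_real_derivative a2) (at 0)"
      "(b' has_real_derivative b2) (at 0)" "(\<phi>' has_real_derivative \<phi>2) (at 0)"
    and N: "\<And>x. \<bar>x\<bar> < \<delta> \<Longrightarrow> (a x)\<^sup>2 + (b x)\<^sup>2 < 1" and c: "\<And>x. \<bar>x\<bar> < \<delta> \<Longrightarrow> cos (k * \<phi> x) > 0"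
    and max: "\<And>x. \<bar>x\<bar> < \<delta> \<Longrightarrow> l x - ln (1 - ((a x)\<^sup>2 + (b x)\<^sup>2)) + ln (cos (k * \<phi> x))
        \<le> l 0 - ln (1 - ((a 0)\<^sup>2 + (b 0)\<^sup>2)) + ln (cos (k * \<phi> 0))"
  shows "l2 + 2 * ((a' 0)\<^sup>2 + (b' 0)\<^sup>2 + a 0 * a2 + b 0 * b2) / (1 - ((a 0)\<^sup>2 + (b 0)\<^sup>2))
     + 4 * (a 0 * a' 0 + b 0 * b' 0)\<^sup>2 / (1 - ((a 0)\<^sup>2 + (b 0)\<^sup>2))\<^sup>2
     - k\<^sup>2 * (\<phi>' 0)\<^sup>2 / (cos (k * \<phi> 0))\<^sup>2 - k * tan (k * \<phi> 0) * \<phi>2 \<le> 0" (is "?D \<le> 0")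
proof -
  let ?V = "\<lambda>x. l' x + 2 * (a x * a' x + b x * b' x) / (1 - ((a x)\<^sup>2 + (b x)\<^sup>2)) - k * tan (k * \<phi> x) * \<phi>' x"
  have U: "((\<lambda>x. l x - ln (1 - ((a x)\<^sup>2 + (b x)\<^sup>2)) + ln (cos (k * \<phi> x))) has_real_derivative ?V x) (at x)"
    if x: "\<bar>x\<bar> < \<delta>" for x
  proof -
    have "((\<lambda>x. 1 - ((a x)\<^sup>2 + (b x)\<^sup>2)) has_real_derivative - (2 * (a x * a' x + b x * b' x))) (at x)"
      by (rule derivative_eq_intros D1[OF x] refl)+ (simp add: algebra_simps)
    from DERIV_chain'[OF this DERIV_ln_divide[of "1 - ((a x)\<^sup>2 + (b x)\<^sup>2)"]]
    have 1: "((\<lambda>x. ln (1 - ((a x)\<^sup>2 + (b x)\<^sup>2))) has_real_derivative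
        1 / (1 - ((a x)\<^sup>2 + (b x)\<^sup>2)) * - (2 * (a x * a' x + b x * b' x))) (at x)"
      using N[OF x] by simp
    have "((\<lambda>x. cos (k * \<phi> x)) has_real_derivative - sin (k * \<phi> x) * (k * \<phi>' x)) (at x)"
      by (rule derivative_eq_intros D1[OF x] refl)+ simp
    from DERIV_chain'[OF this DERIV_ln_divide[of "cos (k * \<phi> x)"]]
    have 2: "((\<lambda>x. ln (cos (k * \<phi> x))) has_real_derivative
        1 / cos (k * \<phi> x) * (- sin (k * \<phi> x) * (k * \<phi>' x))) (at x)"
      using c[OF x] by simp
    have "A - 1 / n * - B + 1 / c * (- s * (k * d)) = A + B / n - k * (s / c) * d" for A B c d n s :: real
      by (simp add: divide_inverse mult_ac)
    then show ?thesis
      unfolding tan_def by (rule DERIV_cong[OF DERIV_add[OF DERIV_diff[OF D1(1)[OF x] 1] 2]])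
  qed
  have n: "1 - ((a 0)\<^sup>2 + (b 0)\<^sup>2) \<noteq> 0" "cos (k * \<phi> 0) \<noteq> 0" using N[of 0] c[of 0] d by auto
  note D0 = D1(2-)[of 0, simplified, OF d]
  have T: "((\<lambda>x. tan (k * \<phi> x)) has_real_derivative k * \<phi>' 0 / (cos (k * \<phi> 0))\<^sup>2) (at 0)"
    using n by (auto intro!: derivative_eq_intros D0 simp: divide_inverse)
  have M: "((\<lambda>x. 2 * (a x * a' x + b x * b' x)) has_real_derivative
      2 * ((a' 0)\<^sup>2 + (b' 0)\<^sup>2 + a 0 * a2 + b 0 * b2)) (at 0)"
    by (rule derivative_eq_intros D0 D2 refl)+ (simp add: power2_eq_square algebra_simps)
  have Nd: "((\<lambda>x. 1 - ((a x)\<^sup>2 + (b x)\<^sup>2)) has_real_derivative - (2 * (a 0 * a' 0 + b 0 * b' 0))) (at 0)"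
    by (rule derivative_eq_intros D0 D2 refl)+ (simp add: algebra_simps)
  have "(?V has_real_derivative l2 + (2 * ((a' 0)\<^sup>2 + (b' 0)\<^sup>2 + a 0 * a2 + b 0 * b2) * (1 - ((a 0)\<^sup>2 + (b 0)\<^sup>2))
      - 2 * (a 0 * a' 0 + b 0 * b' 0) * - (2 * (a 0 * a' 0 + b 0 * b' 0))) /
        ((1 - ((a 0)\<^sup>2 + (b 0)\<^sup>2)) * (1 - ((a 0)\<^sup>2 + (b 0)\<^sup>2))) -
      (k * (k * \<phi>' 0 / (cos (k * \<phi> 0))\<^sup>2) * \<phi>' 0 + \<phi>2 * (k * tan (k * \<phi> 0)))) (at 0)"
    by (intro DERIV_diff DERIV_add DERIV_divide DERIV_mult DERIV_cmult M Nd T D2 n)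
  moreover have frac: "A / n + B / n\<^sup>2 = (A * n - C * - C) / (n * n)" if "n \<noteq> 0" "B = C * C" for A B C n :: real
    using that by (simp add: field_simps power2_eq_square)
  have "2 * ((a' 0)\<^sup>2 + (b' 0)\<^sup>2 + a 0 * a2 + b 0 * b2) / (1 - ((a 0)\<^sup>2 + (b 0)\<^sup>2))
     + 4 * (a 0 * a' 0 + b 0 * b' 0)\<^sup>2 / (1 - ((a 0)\<^sup>2 + (b 0)\<^sup>2))\<^sup>2 =
     (2 * ((a' 0)\<^sup>2 + (b' 0)\<^sup>2 + a 0 * a2 + b 0 * b2) * (1 - ((a 0)\<^sup>2 + (b 0)\<^sup>2))
      - 2 * (a 0 * a' 0 + b 0 * b' 0) * - (2 * (a 0 * a' 0 + b 0 * b' 0))) /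
        ((1 - ((a 0)\<^sup>2 + (b 0)\<^sup>2)) * (1 - ((a 0)\<^sup>2 + (b 0)\<^sup>2)))"
    by (rule frac[OF n(1)]) algebra
  moreover have "k * (k * \<phi>' 0 / (cos (k * \<phi> 0))\<^sup>2) * \<phi>' 0 + \<phi>2 * (k * tan (k * \<phi> 0))
      = k\<^sup>2 * (\<phi>' 0)\<^sup>2 / (cos (k * \<phi> 0))\<^sup>2 + k * tan (k * \<phi> 0) * \<phi>2"
    by (simp add: power2_eq_square)
  ultimately have V: "(?V has_real_derivative ?D) (at 0)"
    by (elim DERIV_cong) linarith
  show ?thesis
    by (rule second_derivative_nonpos_at_max[where V = ?V, OF d U V max])
qed

lemma holomorphic_line_derivative:
  assumes "F holomorphic_on ball z0 \<epsilon>" "\<bar>x\<bar> < \<epsilon>" "norm e = 1"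
  shows "((\<lambda>x. Re (F (z0 + of_real x * e))) has_real_derivative Re (deriv F (z0 + of_real x * e) * e)) (at x)"
    "((\<lambda>x. Im (F (z0 + of_real x * e))) has_real_derivative Im (deriv F (z0 + of_real x * e) * e)) (at x)"
proof -
  have "z0 + of_real x * e \<in> ball z0 \<epsilon>" using assms by (simp add: dist_norm norm_mult)
  then have F: "(F has_field_derivative deriv F (z0 + of_real x * e)) (at (z0 + of_real x * e))"
    using assms(1) holomorphic_derivI open_ball by blast
  have "((\<lambda>x. z0 + of_real x * e) has_vector_derivative e) (at x)"
    by (auto intro!: derivative_eq_intros)
  from field_vector_diff_chain_at[OF this F]
  have "((\<lambda>x. F (z0 + of_real x * e)) has_vector_derivative deriv F (z0 + of_real x * e) * e) (at x)"
    by (simp add: o_def mult.commute)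
  then show "((\<lambda>x. Re (F (z0 + of_real x * e))) has_real_derivative Re (deriv F (z0 + of_real x * e) * e)) (at x)"
    "((\<lambda>x. Im (F (z0 + of_real x * e))) has_real_derivative Im (deriv F (z0 + of_real x * e) * e)) (at x)"
    unfolding has_real_derivative_iff_has_vector_derivative
    by - (erule bounded_linear.has_vector_derivative[OF bounded_linear_Re]
        bounded_linear.has_vector_derivative[OF bounded_linear_Im])+
qed

text \<open>Ahlfors' argument: for the logarithm of the quotient of the pulled-back hyperbolic metric of the
  disc by that of the strip, the second derivatives in two orthogonal directions add up to
  the difference of the squared densities.\<close>

lemma hyperbolic_density_at_max:
  fixes f g :: "complex \<Rightarrow> complex"
  assumes eps: "\<epsilon> > 0" and f: "f holomorphic_on ball z0 \<epsilon>" and g: "g holomorphic_on ball z0 \<epsilon>"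
    and g1: "\<And>z. z \<in> ball z0 \<epsilon> \<Longrightarrow> norm (g z) < 1"
    and f0: "deriv f z0 \<noteq> 0" and g0: "deriv g z0 \<noteq> 0" and c0: "cos (k * (Re (f z0) - m)) > 0"
    and max: "\<And>z. z \<in> ball z0 \<epsilon> \<Longrightarrow>
      (norm (deriv g z))\<^sup>2 / ((norm (deriv f z))\<^sup>2 * (1 - (norm (g z))\<^sup>2)\<^sup>2) * (cos (k * (Re (f z) - m)))\<^sup>2
      \<le> (norm (deriv g z0))\<^sup>2 / ((norm (deriv f z0))\<^sup>2 * (1 - (norm (g z0))\<^sup>2)\<^sup>2) * (cos (k * (Re (f z0) - m)))\<^sup>2"
  shows "4 * ((norm (deriv g z0))\<^sup>2 / ((norm (deriv f z0))\<^sup>2 * (1 - (norm (g z0))\<^sup>2)\<^sup>2) * (cos (k * (Re (f z0) - m)))\<^sup>2)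
     \<le> k\<^sup>2"
proof -
  define S where "S = {z \<in> ball z0 \<epsilon>. deriv f z \<noteq> 0 \<and> deriv g z \<noteq> 0 \<and> cos (k * (Re (f z) - m)) > 0}"
  have f': "deriv f holomorphic_on ball z0 \<epsilon>" and g': "deriv g holomorphic_on ball z0 \<epsilon>"
    using f g by (simp_all add: holomorphic_deriv)
  note cont = f[THEN holomorphic_on_imp_continuous_on] f'[THEN holomorphic_on_imp_continuous_on]
    g'[THEN holomorphic_on_imp_continuous_on]
  have "open S"
  proof -
    have "open (ball z0 \<epsilon> \<inter> (\<lambda>z. (deriv f z, deriv g z, cos (k * (Re (f z) - m)))) -` ((- {0}) \<times> (- {0}) \<times> {0<..}))"
      by (intro continuous_open_preimage continuous_intros cont open_Times) auto
    moreover have "ball z0 \<epsilon> \<inter> (\<lambda>z. (deriv f z, deriv g z, cos (k * (Re (f z) - m)))) -` ((- {0}) \<times> (- {0}) \<times> {0<..}) = S"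
      by (auto simp: S_def)
    ultimately show ?thesis by simp
  qed
  moreover have "z0 \<in> S" using assms by (simp add: S_def)
  ultimately obtain \<delta> where \<delta>: "\<delta> > 0" "ball z0 \<delta> \<subseteq> S" using openE by blast
  have sub: "ball z0 \<delta> \<subseteq> ball z0 \<epsilon>" using \<delta>(2) by (auto simp: S_def)
  \<comment> \<open>A holomorphic logarithm \<open>L\<close> of \<open>Q\<close> exists on the disc;
    its real part log |g' / f'| is harmonic, so its second derivatives along 1 and \<i> are
    opposite.\<close>
  define Q where "Q z = deriv g z / deriv f z" for z
  have "Q holomorphic_on ball z0 \<delta>" unfolding Q_def
    using \<delta>(2) by (intro holomorphic_on_divide f'[THEN holomorphic_on_subset] g'[THEN holomorphic_on_subset] sub)
      (auto simp: S_def)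
  moreover have Qn: "Q z \<noteq> 0" if "z \<in> ball z0 \<delta>" for z
    using that \<delta>(2) by (auto simp: Q_def S_def)
  ultimately obtain L where L: "L holomorphic_on ball z0 \<delta>" "\<And>z. z \<in> ball z0 \<delta> \<Longrightarrow> Q z = exp (L z)"
    using contractible_imp_holomorphic_log[of Q "ball z0 \<delta>"] convex_imp_contractible[OF convex_ball] by metis
  define \<Phi> where "\<Phi> z = (norm (deriv g z))\<^sup>2 / ((norm (deriv f z))\<^sup>2 * (1 - (norm (g z))\<^sup>2)\<^sup>2)
      * (cos (k * (Re (f z) - m)))\<^sup>2" for z
  define U where "U z = Re (L z) - ln (1 - (norm (g z))\<^sup>2) + ln (cos (k * (Re (f z) - m)))" for z
  have pos: "1 - (norm (g z))\<^sup>2 > 0" "cos (k * (Re (f z) - m)) > 0" if "z \<in> ball z0 \<delta>" for z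
  proof -
    have "norm (g z) < 1" using g1 that sub by blast
    then show "1 - (norm (g z))\<^sup>2 > 0" by (simp add: power_less_one_iff)
    show "cos (k * (Re (f z) - m)) > 0" using that \<delta>(2) by (auto simp: S_def)
  qed
  have U: "\<Phi> z = (exp (U z))\<^sup>2" if "z \<in> ball z0 \<delta>" for z
  proof -
    have "exp (U z) = norm (Q z) / (1 - (norm (g z))\<^sup>2) * cos (k * (Re (f z) - m))"
      using pos[OF that] L(2)[OF that] by (simp add: U_def exp_add exp_diff)
    then show ?thesis by (simp add: \<Phi>_def Q_def norm_divide power_mult_distrib power_divide)
  qed
  have z0: "z0 \<in> ball z0 \<delta>" using \<delta> by simp
  have Umax: "U z \<le> U z0" if "z \<in> ball z0 \<delta>" for z
  proof -
    have "(exp (U z))\<^sup>2 \<le> (exp (U z0))\<^sup>2"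
      using max[of z] that sub U[OF that] U[OF z0] unfolding \<Phi>_def by auto
    then show ?thesis by (simp add: abs_le_square_iff[symmetric])
  qed
  have ng: "(norm (g z))\<^sup>2 = (Re (g z))\<^sup>2 + (Im (g z))\<^sup>2" for z by (rule cmod_power2)
  define N where "N = 1 - (norm (g z0))\<^sup>2"
  define C where "C = cos (k * (Re (f z0) - m))"
  have NC: "N > 0" "C > 0" using pos[OF z0] by (auto simp: N_def C_def)
  define l2 G F where "l2 = deriv (deriv L) z0" and "G = deriv g z0" and "F = deriv f z0"
  define g2 f2 where "g2 = deriv (deriv g) z0" and "f2 = deriv (deriv f) z0"
  \<comment> \<open>The second derivatives of \<open>L\<close>, \<open>g\<close> and
    \<open>f\<close> enter only linearly through \<open>e * e\<close>; they therefore cancel when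
    the inequalities for the directions 1 and \<i> are added.\<close>
  have main: "Re (l2 * e * e) + 2 * ((Re (G * e))\<^sup>2 + (Im (G * e))\<^sup>2 + Re (g z0) * Re (g2 * e * e) + Im (g z0) * Im (g2 * e * e)) / N
     + 4 * (Re (g z0) * Re (G * e) + Im (g z0) * Im (G * e))\<^sup>2 / N\<^sup>2
     - k\<^sup>2 * (Re (F * e))\<^sup>2 / C\<^sup>2 - k * tan (k * (Re (f z0) - m)) * Re (f2 * e * e) \<le> 0"
    if e: "norm e = 1" for e
  proof -
    have hol: "h holomorphic_on ball z0 \<delta>" if "h holomorphic_on ball z0 \<epsilon>" for h
      using that sub holomorphic_on_subset by blast
    have inb: "z0 + of_real x * e \<in> ball z0 \<delta>" if "\<bar>x\<bar> < \<delta>" for x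
      using that e by (simp add: dist_norm norm_mult)
    have second: "((\<lambda>x. Re (deriv h (z0 + of_real x * e) * e)) has_real_derivative Re (deriv (deriv h) z0 * e * e)) (at 0)"
      "((\<lambda>x. Im (deriv h (z0 + of_real x * e) * e)) has_real_derivative Im (deriv (deriv h) z0 * e * e)) (at 0)"
      if "h holomorphic_on ball z0 \<delta>" for h
    proof -
      have "deriv h holomorphic_on ball z0 \<delta>" using holomorphic_deriv[OF that] by simp
      then have hh: "(\<lambda>z. deriv h z * e) holomorphic_on ball z0 \<delta>"
        by (intro holomorphic_on_mult holomorphic_on_const)
      have "deriv h field_differentiable at z0"
        using \<open>deriv h holomorphic_on ball z0 \<delta>\<close> z0 holomorphic_on_imp_differentiable_at open_ball by blast
      then have "deriv (\<lambda>z. deriv h z * e) z0 = deriv (deriv h) z0 * e" by (simp add: deriv_cmult_right)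
      with holomorphic_line_derivative[OF hh, of 0 e] e \<delta>(1)
      show "((\<lambda>x. Re (deriv h (z0 + of_real x * e) * e)) has_real_derivative Re (deriv (deriv h) z0 * e * e)) (at 0)"
      "((\<lambda>x. Im (deriv h (z0 + of_real x * e) * e)) has_real_derivative Im (deriv (deriv h) z0 * e * e)) (at 0)"
        by simp_all
    qed
    note first = holomorphic_line_derivative[OF _ _ e]
    have "Re (l2 * e * e) + 2 * ((Re (deriv g (z0 + of_real 0 * e) * e))\<^sup>2 + (Im (deriv g (z0 + of_real 0 * e) * e))\<^sup>2
        + Re (g (z0 + of_real 0 * e)) * Re (g2 * e * e) + Im (g (z0 + of_real 0 * e)) * Im (g2 * e * e))
          / (1 - ((Re (g (z0 + of_real 0 * e)))\<^sup>2 + (Im (g (z0 + of_real 0 * e)))\<^sup>2))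
     + 4 * (Re (g (z0 + of_real 0 * e)) * Re (deriv g (z0 + of_real 0 * e) * e)
         + Im (g (z0 + of_real 0 * e)) * Im (deriv g (z0 + of_real 0 * e) * e))\<^sup>2
          / (1 - ((Re (g (z0 + of_real 0 * e)))\<^sup>2 + (Im (g (z0 + of_real 0 * e)))\<^sup>2))\<^sup>2
     - k\<^sup>2 * (Re (deriv f (z0 + of_real 0 * e) * e))\<^sup>2 / (cos (k * (Re (f (z0 + of_real 0 * e)) - m)))\<^sup>2
     - k * tan (k * (Re (f (z0 + of_real 0 * e)) - m)) * Re (f2 * e * e) \<le> 0"
    proof (rule log_density_second_derivative[OF \<delta>(1),
        where l = "\<lambda>x. Re (L (z0 + of_real x * e))" and a = "\<lambda>x. Re (g (z0 + of_real x * e))"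
          and b = "\<lambda>x. Im (g (z0 + of_real x * e))" and \<phi> = "\<lambda>x. Re (f (z0 + of_real x * e)) - m"
          and l' = "\<lambda>x. Re (deriv L (z0 + of_real x * e) * e)" and a' = "\<lambda>x. Re (deriv g (z0 + of_real x * e) * e)"
          and b' = "\<lambda>x. Im (deriv g (z0 + of_real x * e) * e)" and \<phi>' = "\<lambda>x. Re (deriv f (z0 + of_real x * e) * e)"])
      fix x :: real assume x: "\<bar>x\<bar> < \<delta>"
      show "((\<lambda>x. Re (L (z0 + of_real x * e))) has_real_derivative Re (deriv L (z0 + of_real x * e) * e)) (at x)"
        by (rule first[OF L(1) x])
      show "((\<lambda>x. Re (g (z0 + of_real x * e))) has_real_derivative Re (deriv g (z0 + of_real x * e) * e)) (at x)"
        "((\<lambda>x. Im (g (z0 + of_real x * e))) has_real_derivative Im (deriv g (z0 + of_real x * e) * e)) (at x)"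
        by (rule first[OF hol[OF g] x])+
      show "((\<lambda>x. Re (f (z0 + of_real x * e)) - m) has_real_derivative Re (deriv f (z0 + of_real x * e) * e)) (at x)"
        using DERIV_diff[OF first(1)[OF hol[OF f] x] DERIV_const, of m] by simp
      show "(Re (g (z0 + of_real x * e)))\<^sup>2 + (Im (g (z0 + of_real x * e)))\<^sup>2 < 1"
        using pos(1)[OF inb[OF x]] unfolding ng by simp
      show "0 < cos (k * (Re (f (z0 + of_real x * e)) - m))"
        using pos(2)[OF inb[OF x]] .
      show "Re (L (z0 + of_real x * e)) - ln (1 - ((Re (g (z0 + of_real x * e)))\<^sup>2 + (Im (g (z0 + of_real x * e)))\<^sup>2)) +
          ln (cos (k * (Re (f (z0 + of_real x * e)) - m)))
        \<le> Re (L (z0 + of_real 0 * e)) - ln (1 - ((Re (g (z0 + of_real 0 * e)))\<^sup>2 + (Im (g (z0 + of_real 0 * e)))\<^sup>2)) +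
          ln (cos (k * (Re (f (z0 + of_real 0 * e)) - m)))"
        using Umax[OF inb[OF x]] unfolding U_def ng by simp
    qed (unfold l2_def g2_def f2_def, (rule second[OF L(1)] second[OF hol[OF g]] second[OF hol[OF f]])+)
    then show ?thesis unfolding N_def C_def G_def F_def ng by simp
  qed
  \<comment> \<open>The inner products of g with G and \<i> G have squares adding up to |g|^2 |G|^2,
    and |g|^2 = 1 - N.\<close>
  have s1: "(Re (g z0) * Re G + Im (g z0) * Im G)\<^sup>2 + (Re (g z0) * - Im G + Im (g z0) * Re G)\<^sup>2
      = (1 - N) * (norm G)\<^sup>2"
    unfolding N_def cmod_power2 by (simp add: power2_eq_square algebra_simps)
  define u K where "u = Re (g z0) * Re g2 + Im (g z0) * Im g2" and "K = k * tan (k * (Re (f z0) - m)) * Re f2"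
  have "Re l2 + 2 * ((norm G)\<^sup>2 + u) / N + 4 * (Re (g z0) * Re G + Im (g z0) * Im G)\<^sup>2 / N\<^sup>2
     - k\<^sup>2 * (Re F)\<^sup>2 / C\<^sup>2 - K \<le> 0"
    using main[of 1] by (simp add: u_def K_def cmod_power2 add.assoc)
  moreover have "- Re l2 + 2 * ((norm G)\<^sup>2 - u) / N + 4 * (Re (g z0) * - Im G + Im (g z0) * Re G)\<^sup>2 / N\<^sup>2
     - k\<^sup>2 * (Im F)\<^sup>2 / C\<^sup>2 + K \<le> 0"
  proof -
    have i: "Re (l2 * \<i> * \<i>) = - Re l2" "Re (G * \<i>) = - Im G" "Im (G * \<i>) = Re G" "Re (F * \<i>) = - Im F"
      "Re (f2 * \<i> * \<i>) = - Re f2" by simp_all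
    have v: "(- Im G)\<^sup>2 + (Re G)\<^sup>2 + Re (g z0) * Re (g2 * \<i> * \<i>) + Im (g z0) * Im (g2 * \<i> * \<i>) = (norm G)\<^sup>2 - u"
      by (simp add: u_def cmod_power2)
    show ?thesis using main[of \<i>] unfolding i v by (simp add: K_def)
  qed
  moreover have "2 * ((norm G)\<^sup>2 + u) / N + 2 * ((norm G)\<^sup>2 - u) / N = 4 * (norm G)\<^sup>2 / N"
    by (simp add: add_divide_distrib[symmetric])
  moreover have "4 * (Re (g z0) * Re G + Im (g z0) * Im G)\<^sup>2 / N\<^sup>2
      + 4 * (Re (g z0) * - Im G + Im (g z0) * Re G)\<^sup>2 / N\<^sup>2 = 4 * ((1 - N) * (norm G)\<^sup>2) / N\<^sup>2"
    unfolding s1[symmetric] by (simp add: add_divide_distrib)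
  moreover have "k\<^sup>2 * (Re F)\<^sup>2 / C\<^sup>2 + k\<^sup>2 * (Im F)\<^sup>2 / C\<^sup>2 = k\<^sup>2 * (norm F)\<^sup>2 / C\<^sup>2"
    unfolding cmod_power2 by (simp add: add_divide_distrib distrib_left)
  ultimately have "4 * (norm G)\<^sup>2 / N + 4 * ((1 - N) * (norm G)\<^sup>2) / N\<^sup>2 - k\<^sup>2 * (norm F)\<^sup>2 / C\<^sup>2 \<le> 0"
    by linarith
  \<comment> \<open>This is 1 / N + (1 - N) / N^2 = 1 / N^2, which leaves exactly the squared
    density of the disc metric.\<close>
  moreover have "4 * (norm G)\<^sup>2 / N + 4 * ((1 - N) * (norm G)\<^sup>2) / N\<^sup>2 = 4 * (norm G)\<^sup>2 / N\<^sup>2"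
  proof -
    have "x / N + (1 - N) * x / N\<^sup>2 = x / N\<^sup>2" for x
    proof -
      have "x / N = N * x / N\<^sup>2" using NC by (simp add: power2_eq_square)
      then show ?thesis by (simp add: add_divide_distrib[symmetric] left_diff_distrib)
    qed
    from this[of "4 * (norm G)\<^sup>2"] show ?thesis by (simp add: mult.left_commute)
  qed
  ultimately have "4 * (norm G)\<^sup>2 / N\<^sup>2 \<le> k\<^sup>2 * (norm F)\<^sup>2 / C\<^sup>2" by linarith
  then have "4 * (norm G)\<^sup>2 / ((norm F)\<^sup>2 * N\<^sup>2) * C\<^sup>2 \<le> k\<^sup>2"
  proof -
    assume "4 * (norm G)\<^sup>2 / N\<^sup>2 \<le> k\<^sup>2 * (norm F)\<^sup>2 / C\<^sup>2"
    then have "4 * (norm G)\<^sup>2 / N\<^sup>2 * C\<^sup>2 \<le> k\<^sup>2 * (norm F)\<^sup>2"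
      using NC by (simp add: pos_le_divide_eq)
    moreover have "(norm F)\<^sup>2 > 0" using f0 F_def by simp
    ultimately have "4 * (norm G)\<^sup>2 / N\<^sup>2 * C\<^sup>2 / (norm F)\<^sup>2 \<le> k\<^sup>2"
      by (simp only: pos_divide_le_eq)
    then show ?thesis by (simp add: mult.commute)
  qed
  then show ?thesis unfolding G_def F_def N_def C_def by simp
qed

subsection \<open>Plane topology\<close>

lemma Janiszewski_plane:
  fixes a b :: "real \<times> real"
  assumes "compact S" "closed T" and conST: "connected (S \<inter> T)"
    and ccS: "connected_component (- S) a b" and ccT: "connected_component (- T) a b"
  shows "connected_component (- (S \<union> T)) a b"
proof -
  define \<iota> where "\<iota> = (\<lambda>z::real \<times> real. Complex (fst z) (snd z))"
  define \<kappa> where "\<kappa> = (\<lambda>z. (Re z, Im z))"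
  have inv: "\<kappa> (\<iota> z) = z" "\<iota> (\<kappa> w) = w" for z w by (simp_all add: \<iota>_def \<kappa>_def)
  have ci: "continuous_on X \<iota>" for X
    unfolding \<iota>_def Complex_eq by (intro continuous_intros)
  have ck: "continuous_on X \<kappa>" for X unfolding \<kappa>_def by (intro continuous_intros)
  have img: "\<iota> ` X = \<kappa> -` X" for X
  proof (intro equalityI subsetI)
    show "w \<in> \<iota> ` X" if "w \<in> \<kappa> -` X" for w using that image_eqI[of w \<iota> "\<kappa> w" X] inv by simp
  qed (auto simp: inv)
  have T: "connected_component (- (\<iota> ` X)) (\<iota> u) (\<iota> v)" if cc: "connected_component (- X) u v" for X u v
  proof -
    obtain C where C: "connected C" "C \<subseteq> - X" "u \<in> C" "v \<in> C" using cc unfolding connected_component_def by blast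
    then have "connected (\<iota> ` C)" "\<iota> ` C \<subseteq> - (\<iota> ` X)"
      using connected_continuous_image[OF ci] inv by (auto simp: img)
    then show ?thesis using C unfolding connected_component_def by blast
  qed
  have "connected_component (- (\<iota> ` S \<union> \<iota> ` T)) (\<iota> a) (\<iota> b)"
  proof (rule Janiszewski)
    show "compact (\<iota> ` S)" using assms(1) ci compact_continuous_image by blast
    show "closed (\<iota> ` T)"
      unfolding img using \<open>closed T\<close> ck[of UNIV] by (simp add: closed_vimage)
    have "\<iota> ` S \<inter> \<iota> ` T = \<iota> ` (S \<inter> T)" unfolding img by blast
    then show "connected (\<iota> ` S \<inter> \<iota> ` T)" using conST ci connected_continuous_image by metis
  qed (use T ccS ccT in auto)
  then obtain C where C: "connected C" "C \<subseteq> - (\<iota> ` S \<union> \<iota> ` T)" "\<iota> a \<in> C" "\<iota> b \<in> C"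
    unfolding connected_component_def by blast
  have "connected (\<kappa> ` C)" using C(1) ck connected_continuous_image by blast
  moreover have "\<kappa> ` C \<subseteq> - (S \<union> T)" using C(2) unfolding img by auto
  moreover have "a \<in> \<kappa> ` C" "b \<in> \<kappa> ` C"
    using imageI[OF C(3), of \<kappa>] imageI[OF C(4), of \<kappa>] inv(1) by simp_all
  ultimately show ?thesis unfolding connected_component_def by blast
qed

text \<open>A saddle: near \<open>\<psi> 0\<close> the sets \<open>A\<close> and \<open>B\<close> contain at least two sectors each, in alternating
  order. Two neighbouring \<open>B\<close>-sectors are joined outside the small disc, which together with two
  radii would separate two \<open>A\<close>-sectors.\<close>

lemma no_alternating_sectors:
  fixes \<psi> :: "complex \<Rightarrow> real \<times> real"
  assumes r: "r > 0" and cont: "continuous_on (ball 0 r) \<psi>" and inj: "inj_on \<psi> (ball 0 r)"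
    and n: "n \<ge> 2" and A: "connected A" and B: "open B" "connected B" and AB: "A \<inter> B = {}"
    and sA: "\<And>w. w \<in> ball 0 r \<Longrightarrow> Re (w ^ n) > 0 \<Longrightarrow> \<psi> w \<in> A"
    and sB: "\<And>w. w \<in> ball 0 r \<Longrightarrow> \<psi> w \<in> B \<longleftrightarrow> Re (w ^ n) < 0"
    and s0: "\<psi> 0 \<notin> A"
  shows False
proof -
  define \<rho> where "\<rho> = r / 2"
  have \<rho>: "\<rho> > 0" "\<rho> < r" using r by (auto simp: \<rho>_def)
  define N where "N = \<psi> ` ball 0 \<rho>"
  define D where "D = \<psi> ` cball 0 \<rho>"
  have cb: "cball 0 \<rho> \<subseteq> ball (0::complex) r" "ball 0 \<rho> \<subseteq> ball (0::complex) r" using \<rho> by auto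
  have contb: "continuous_on X \<psi>" if "X \<subseteq> cball 0 \<rho>" for X
    using cont cb that continuous_on_subset by blast
  have opN: "open N" unfolding N_def
    by (rule invariance_of_domain_gen) (use cont inj cb in \<open>auto intro: continuous_on_subset inj_on_subset\<close>)
  have clD: "closed D" unfolding D_def
    using compact_continuous_image[OF contb[OF order_refl] compact_cball] compact_imp_closed by blast
  define \<xi> where "\<xi> = inv_into (ball 0 r) \<psi>"
  have \<xi>: "\<xi> (\<psi> w) = w" if "w \<in> ball 0 r" for w
    using inj that by (simp add: \<xi>_def)
  have c\<xi>: "continuous_on (\<psi> ` ball 0 r) \<xi>"
    by (rule continuous_on_inverse_open[OF open_ball cont]) (simp_all add: \<xi>)
  have ND: "N \<subseteq> D" by (auto simp: N_def D_def)
  have D_in: "D \<subseteq> \<psi> ` ball 0 r" using cb by (auto simp: D_def)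
  have inN: "\<psi> w \<in> N \<longleftrightarrow> norm w < \<rho>" if "norm w < r" for w
  proof
    assume "\<psi> w \<in> N"
    then obtain v where v: "v \<in> ball 0 \<rho>" "\<psi> w = \<psi> v" by (auto simp: N_def)
    with inj cb that have "w = v" by (metis inj_onD mem_ball_0 subsetD)
    then show "norm w < \<rho>" using v by simp
  qed (simp add: N_def)
  \<comment> \<open>The angles \<theta> and - \<theta> bisect the two \<open>B\<close>-sectors next
    to the \<open>A\<close>-sector around the positive real axis, and 2 \<theta> bisects the
    following \<open>A\<close>-sector. Since n \<ge> 2 gives 2 \<theta> \<le> pi, the two
    \<open>A\<close>-sectors are different.\<close>
  define \<theta> where "\<theta> = pi / n"
  have \<theta>: "0 < \<theta>" "\<theta> \<le> pi / 2" "n * \<theta> = pi" using n by (auto simp: \<theta>_def field_simps)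
  have cisn: "cis \<theta> ^ n = -1" "cis (- \<theta>) ^ n = -1" "cis (2 * \<theta>) ^ n = 1"
  proof -
    have m: "n * (2 * \<theta>) = 2 * pi" "n * (- \<theta>) = - pi" using \<theta>(3) by auto
    show "cis \<theta> ^ n = -1" "cis (- \<theta>) ^ n = -1" "cis (2 * \<theta>) ^ n = 1"
      unfolding Complex.DeMoivre \<theta>(3) m by (auto simp: cis_pi complex_eq_iff)
  qed
  have rayB: "\<psi> (of_real x * cis \<alpha>) \<in> B" if "0 < x" "x \<le> \<rho>" "\<alpha> = \<theta> \<or> \<alpha> = - \<theta>" for x \<alpha>
  proof -
    have "(of_real x * cis \<alpha>) ^ n = - of_real (x ^ n)" using cisn that by (auto simp: power_mult_distrib)
    then have "Re ((of_real x * cis \<alpha>) ^ n) < 0" using that by simp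
    then show ?thesis using sB[of "of_real x * cis \<alpha>"] that \<rho> by (simp add: norm_mult)
  qed
  \<comment> \<open>Radial projection of the punctured disc to its boundary circle. Scaling w by a
    positive real keeps the sign of Re (w^n), so \<open>R\<close> maps \<open>B\<close> into
    \<open>B\<close> and moves a path in \<open>B\<close> off the open disc
    \<open>N\<close>.\<close>
  define R where "R x = (if x \<in> D then \<psi> (of_real (\<rho> / norm (\<xi> x)) * \<xi> x) else x)" for x
  have Rout: "R x = x" if "x \<notin> N" for x
  proof (cases "x \<in> D")
    case True
    then obtain w where w: "norm w \<le> \<rho>" "x = \<psi> w" by (auto simp: D_def)
    then have "norm w = \<rho>" using inN[of w] \<open>x \<notin> N\<close> \<rho> by auto
    then show ?thesis using w \<xi>[of w] \<rho> by (simp add: R_def)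
  qed (simp add: R_def)
  have Rin: "\<xi> x \<noteq> 0" "R x \<in> B" "R x \<notin> N" if "x \<in> B" "x \<in> D" for x
  proof -
    obtain w where w: "norm w \<le> \<rho>" "x = \<psi> w" using \<open>x \<in> D\<close> by (auto simp: D_def)
    then have cw: "\<xi> x = w" using \<xi>[of w] \<rho> by simp
    have neg: "Re (w ^ n) < 0" using sB[of w] w that \<rho> by simp
    then have w0: "w \<noteq> 0" using n by (auto simp: power_0_left)
    then show "\<xi> x \<noteq> 0" using cw by simp
    let ?v = "of_real (\<rho> / norm w) * w"
    have nv: "norm ?v = \<rho>" unfolding norm_mult norm_of_real using w0 \<rho> by simp
    have "Re ((of_real x * w) ^ n) = x ^ n * Re (w ^ n)" for x
      by (simp add: power_mult_distrib flip: of_real_power)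
    then have "Re (?v ^ n) = (\<rho> / norm w) ^ n * Re (w ^ n)" by blast
    moreover have "(\<rho> / norm w) ^ n > 0" using w0 \<rho> by simp
    ultimately have "Re (?v ^ n) < 0" using neg by (simp add: mult_pos_neg)
    moreover have "?v \<in> ball 0 r" "norm ?v < r" using nv \<rho> by (simp_all del: norm_mult)
    ultimately have "\<psi> ?v \<in> B" "\<psi> ?v \<notin> N" using sB inN nv by (blast, metis less_irrefl)
    moreover have "R x = \<psi> ?v" using that(2) cw unfolding R_def by presburger
    ultimately show "R x \<in> B" "R x \<notin> N" by metis+
  qed
  have RB: "R x \<in> B" "R x \<notin> N" if "x \<in> B" for x
  proof -
    have "R x \<in> B \<and> R x \<notin> N"
    proof (cases "x \<in> D")
      case True
      with Rin(2,3)[OF that] show ?thesis by blast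
    next
      case False
      then have "x \<notin> N" using ND by blast
      with Rout[of x] that show ?thesis by metis
    qed
    then show "R x \<in> B" "R x \<notin> N" by blast+
  qed
  have cR: "continuous_on B R"
  proof -
    have e: "B \<inter> D \<union> (B - N) = B" using ND by auto
    have "continuous_on (B \<inter> D) (\<lambda>x. \<psi> (of_real (\<rho> / norm (\<xi> x)) * \<xi> x))"
    proof (rule continuous_on_compose2[OF contb[OF order_refl]])
      have "continuous_on (B \<inter> D) \<xi>" by (rule continuous_on_subset[OF c\<xi>]) (use D_in in auto)
      then show "continuous_on (B \<inter> D) (\<lambda>x. of_real (\<rho> / norm (\<xi> x)) * \<xi> x)"
        using Rin(1) by (intro continuous_intros) auto
      show "(\<lambda>x. of_real (\<rho> / norm (\<xi> x)) * \<xi> x) ` (B \<inter> D) \<subseteq> cball 0 \<rho>"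
      proof -
        have "norm (of_real (\<rho> / norm (\<xi> x)) * \<xi> x) = \<rho>" if "x \<in> B \<inter> D" for x
          unfolding norm_mult norm_of_real using Rin(1)[of x] that \<rho> by simp
        then show ?thesis by (auto simp del: norm_mult)
      qed
    qed
    then have 1: "continuous_on (B \<inter> D) R" by (rule continuous_on_eq) (simp add: R_def)
    have 2: "continuous_on (B - N) R"
      by (rule continuous_on_eq[OF continuous_on_id]) (simp add: Rout)
    have "continuous_on (B \<inter> D \<union> (B - N)) R"
    proof (rule continuous_on_Un_local[OF _ _ 1 2])
      show "closedin (top_of_set (B \<inter> D \<union> (B - N))) (B \<inter> D)"
        unfolding e using clD by (simp add: closedin_closed_Int)
      have "B - N = B \<inter> (- N)" by auto
      then show "closedin (top_of_set (B \<inter> D \<union> (B - N))) (B - N)"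
        unfolding e using opN by (metis closedin_closed_Int closed_Compl)
    qed
    then show ?thesis unfolding e .
  qed
  have p1: "\<psi> (of_real \<rho> * cis \<theta>) \<in> B" "\<psi> (of_real \<rho> * cis (- \<theta>)) \<in> B" using rayB \<rho> by auto
  have "path_connected B" using B connected_open_path_connected by blast
  then obtain \<beta> where \<beta>: "path \<beta>" "path_image \<beta> \<subseteq> B" "pathstart \<beta> = \<psi> (of_real \<rho> * cis \<theta>)"
      "pathfinish \<beta> = \<psi> (of_real \<rho> * cis (- \<theta>))"
    using p1 unfolding path_connected_def by blast
  define K where "K = R ` path_image \<beta>"
  have K: "compact K" "connected K" "K \<subseteq> B" "K \<inter> N = {}"
  proof -
    have "continuous_on (path_image \<beta>) R" using cR \<beta>(2) continuous_on_subset by blast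
    then show "compact K" "connected K" unfolding K_def
      using \<beta>(1) compact_continuous_image connected_continuous_image compact_path_image connected_path_image by blast+
    show "K \<subseteq> B" "K \<inter> N = {}" unfolding K_def using RB \<beta>(2) by auto
  qed
  have ends: "\<psi> (of_real \<rho> * cis \<theta>) \<in> K" "\<psi> (of_real \<rho> * cis (- \<theta>)) \<in> K"
  proof -
    have "R (pathstart \<beta>) \<in> K" "R (pathfinish \<beta>) \<in> K" unfolding K_def by auto
    moreover have "pathstart \<beta> \<notin> N" "pathfinish \<beta> \<notin> N"
      unfolding \<beta>(3,4) using \<rho> by (auto simp: inN norm_mult)
    ultimately show "\<psi> (of_real \<rho> * cis \<theta>) \<in> K" "\<psi> (of_real \<rho> * cis (- \<theta>)) \<in> K"
      using Rout \<beta>(3,4) by auto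
  qed
  define ray where "ray \<alpha> = (\<lambda>x. \<psi> (of_real x * cis \<alpha>)) ` {0..\<rho>}" for \<alpha>
  have compray: "compact (ray \<alpha>)" for \<alpha>
  proof -
    have "continuous_on {0..\<rho>} (\<lambda>x. \<psi> (of_real x * cis \<alpha>))"
      by (rule continuous_on_compose2[OF contb[OF order_refl]])
        (auto intro!: continuous_intros simp: norm_mult)
    then show ?thesis unfolding ray_def by (rule compact_continuous_image) simp
  qed
  \<comment> \<open>A barrier: the path outside \<open>N\<close>, closed up by the two radii through
    the saddle. It lies in \<open>B\<close> apart from \<psi> 0, hence misses
    \<open>A\<close>.\<close>
  define S where "S = K \<union> ray \<theta> \<union> ray (- \<theta>)"
  have rays: "ray \<alpha> \<subseteq> N \<union> K" "ray \<alpha> \<subseteq> insert (\<psi> 0) B" if "\<alpha> = \<theta> \<or> \<alpha> = - \<theta>" for \<alpha>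
  proof -
    have "ray \<alpha> \<subseteq> (N \<union> K) \<inter> insert (\<psi> 0) B"
      unfolding ray_def
    proof (intro image_subsetI IntI)
      fix x assume "x \<in> {0..\<rho>}"
      then have x: "0 \<le> x" "x \<le> \<rho>" by auto
      show "\<psi> (of_real x * cis \<alpha>) \<in> N \<union> K"
        using ends that x \<rho> inN[of "of_real x * cis \<alpha>"]
        by (cases "x = \<rho>") (auto simp: norm_mult)
      show "\<psi> (of_real x * cis \<alpha>) \<in> insert (\<psi> 0) B"
        using rayB[of x \<alpha>] that x by (cases "x = 0") auto
    qed
    then show "ray \<alpha> \<subseteq> N \<union> K" "ray \<alpha> \<subseteq> insert (\<psi> 0) B" by blast+
  qed
  define a1 a2 where "a1 = complex_of_real (\<rho> / 2)" and "a2 = of_real (\<rho> / 2) * cis (2 * \<theta>)"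
  have aN: "\<psi> a1 \<in> N" "\<psi> a2 \<in> N" using \<rho> by (auto simp: a1_def a2_def inN norm_mult)
  have aA: "\<psi> a1 \<in> A" "\<psi> a2 \<in> A"
  proof -
    have "a1 ^ n = of_real ((\<rho> / 2) ^ n)" "a2 ^ n = of_real ((\<rho> / 2) ^ n)"
      unfolding a1_def a2_def power_mult_distrib cisn by simp_all
    then have "Re (a1 ^ n) > 0" "Re (a2 ^ n) > 0" using \<rho> by (simp_all only: Re_complex_of_real) auto
    moreover have "a1 \<in> ball 0 r" "a2 \<in> ball 0 r" using \<rho> by (auto simp: a1_def a2_def norm_mult)
    ultimately show "\<psi> a1 \<in> A" "\<psi> a2 \<in> A" using sA by auto
  qed
  \<comment> \<open>\<open>A\<close> joins the two points off \<open>S\<close>, the disc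
    \<open>N\<close> joins them off its own complement, and \<open>S\<close> meets that complement
    exactly in the connected set \<open>K\<close>. So they would be joined inside \<open>N\<close>
    without crossing the two radii.\<close>
  have "connected_component (- (S \<union> (- N))) (\<psi> a1) (\<psi> a2)"
  proof (rule Janiszewski_plane)
    show "compact S" unfolding S_def by (intro compact_Un K compray)
    show "closed (- N)" using opN by blast
    have "S \<inter> - N = K" using rays(1) K(4) by (auto simp: S_def)
    then show "connected (S \<inter> - N)" using K by simp
    have "A \<subseteq> - S" using rays(2) AB K(3) s0 unfolding S_def by blast
    then show "connected_component (- S) (\<psi> a1) (\<psi> a2)"
      using A aA unfolding connected_component_def by blast
    have "connected N" unfolding N_def using connected_continuous_image contb connected_ball by (metis ball_subset_cball)
    then show "connected_component (- (- N)) (\<psi> a1) (\<psi> a2)"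
      using aN unfolding connected_component_def by auto
  qed
  then obtain C where C: "connected C" "C \<subseteq> N - S" "\<psi> a1 \<in> C" "\<psi> a2 \<in> C"
    unfolding connected_component_def by auto
  have C': "connected (\<xi> ` C)"
    by (rule connected_continuous_image[OF continuous_on_subset[OF c\<xi>] C(1)]) (use C(2) ND D_in in blast)
  \<comment> \<open>\<open>h\<close> vanishes exactly on the two rays of angle \<theta> and -
    \<theta> and takes opposite signs at \<open>a1\<close> and \<open>a2\<close>, so the
    intermediate value theorem forces the joining set to cross a radius.\<close>
  define h where "h = (\<lambda>w. Re w - norm w * cos \<theta>)"
  have "connected (h ` \<xi> ` C)"
    by (rule connected_continuous_image[OF _ C']) (auto simp: h_def intro!: continuous_intros)
  moreover have "h a1 \<in> h ` \<xi> ` C" "h a2 \<in> h ` \<xi> ` C"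
  proof -
    have "a1 \<in> \<xi> ` C" "a2 \<in> \<xi> ` C"
      using C(3,4) \<xi>[of a1] \<xi>[of a2] \<rho> by (force simp: a1_def a2_def norm_mult)+
    then show "h a1 \<in> h ` \<xi> ` C" "h a2 \<in> h ` \<xi> ` C" by auto
  qed
  moreover have "h a1 \<ge> 0" using \<rho> by (simp add: h_def a1_def)
  moreover have "h a2 \<le> 0"
  proof -
    have "cos (2 * \<theta>) \<le> cos \<theta>" using \<theta> by (intro cos_monotone_0_pi_le) auto
    then show ?thesis using \<rho> by (simp add: h_def a2_def norm_mult)
  qed
  ultimately have "0 \<in> h ` \<xi> ` C" by (meson connectedD_interval)
  then obtain x where x: "x \<in> C" "h (\<xi> x) = 0" by auto
  obtain w where w: "norm w < \<rho>" "x = \<psi> w" using x(1) C(2) by (auto simp: N_def)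
  have "\<xi> x = w" using \<xi>[of w] w \<rho> by simp
  then have hw: "Re w = norm w * cos \<theta>" using x by (simp add: h_def)
  have "(Im w)\<^sup>2 = (norm w * sin \<theta>)\<^sup>2"
  proof -
    have "(norm w)\<^sup>2 = (Re w)\<^sup>2 + (Im w)\<^sup>2" by (rule cmod_power2)
    moreover have "(sin \<theta>)\<^sup>2 + (cos \<theta>)\<^sup>2 = 1" by simp
    ultimately show ?thesis unfolding hw by algebra
  qed
  then have "Im w = norm w * sin \<theta> \<or> Im w = - (norm w * sin \<theta>)" by (simp add: power2_eq_iff)
  then have "w = of_real (norm w) * cis \<theta> \<or> w = of_real (norm w) * cis (- \<theta>)"
    using hw by (auto simp: complex_eq_iff)
  then have "x \<in> ray \<theta> \<union> ray (- \<theta>)"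
  proof (elim disjE)
    have m: "norm w \<in> {0..\<rho>}" using w(1) by simp
    have ray: "\<psi> (of_real (norm w) * cis \<alpha>) \<in> ray \<alpha>" for \<alpha>
      unfolding ray_def by (rule image_eqI[OF refl m])
    show "x \<in> ray \<theta> \<union> ray (- \<theta>)" if e: "w = of_real (norm w) * cis \<theta>"
      using ray[of \<theta>] unfolding e[symmetric] w(2)[symmetric] by blast
    show "x \<in> ray \<theta> \<union> ray (- \<theta>)" if e: "w = of_real (norm w) * cis (- \<theta>)"
      using ray[of "- \<theta>"] unfolding e[symmetric] w(2)[symmetric] by blast
  qed
  then show False using x(1) C(2) unfolding S_def by blast
qed

text \<open>Each complement component is closed and has a non-empty frontier inside the frontier of
  \<Omega>, so it meets \<Gamma>1 or \<Gamma>2. Each \<Gamma> is connected and lies in a single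
  component; with two components on one side and two sets on the other, the assignment is a
  bijection.\<close>

lemma frontier_parts_in_complement_components:
  fixes \<Omega> :: "'a::euclidean_space set"
  assumes op: "open \<Omega>" and ne: "\<Omega> \<noteq> {}" and two: "card (components (- \<Omega>)) = 2"
    and fr: "frontier \<Omega> = \<Gamma>1 \<union> \<Gamma>2" and \<Gamma>: "connected \<Gamma>1" "connected \<Gamma>2"
  obtains Y1 Y2 where "components (- \<Omega>) = {Y1, Y2}" "Y1 \<noteq> Y2" "\<Gamma>1 \<subseteq> Y1" "\<Gamma>2 \<subseteq> Y2"
proof -
  have cl: "closed (- \<Omega>)" using op by (rule closed_Compl)
  have sub: "frontier \<Omega> \<subseteq> - \<Omega>" using op frontier_disjoint_eq by blast
  have comp: "C \<inter> (\<Gamma>1 \<union> \<Gamma>2) \<noteq> {}" if C: "C \<in> components (- \<Omega>)" for C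
  proof -
    have "frontier C \<subseteq> frontier \<Omega>" using frontier_of_components_subset[OF C] by simp
    moreover have "closed C" using closed_components[OF cl C] .
    moreover have "C \<noteq> {}" "C \<noteq> UNIV"
      using in_components_nonempty[OF C] in_components_subset[OF C] ne by auto
    ultimately show ?thesis using frontier_eq_empty[of C] frontier_subset_closed[of C] fr by blast
  qed
  obtain C1 C2 where C: "components (- \<Omega>) = {C1, C2}" "C1 \<noteq> C2" using two by (meson card_2_iff)
  have ex: "\<Gamma> \<subseteq> C1 \<or> \<Gamma> \<subseteq> C2" if "connected \<Gamma>" "\<Gamma> \<subseteq> - \<Omega>" for \<Gamma>
  proof -
    have "- \<Omega> \<noteq> {}" using C(1) by auto
    from exists_component_superset[OF that(2) this that(1)] show ?thesis using C(1) by auto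
  qed
  have "C1 \<inter> C2 = {}" using C components_nonoverlap[of C1 "- \<Omega>" C2] by auto
  moreover have "\<Gamma>1 \<subseteq> C1 \<or> \<Gamma>1 \<subseteq> C2" "\<Gamma>2 \<subseteq> C1 \<or> \<Gamma>2 \<subseteq> C2" using ex \<Gamma> sub fr by blast+
  moreover have "C1 \<inter> (\<Gamma>1 \<union> \<Gamma>2) \<noteq> {}" "C2 \<inter> (\<Gamma>1 \<union> \<Gamma>2) \<noteq> {}" using comp C by auto
  ultimately have "(\<Gamma>1 \<subseteq> C1 \<and> \<Gamma>2 \<subseteq> C2) \<or> (\<Gamma>1 \<subseteq> C2 \<and> \<Gamma>2 \<subseteq> C1)" by blast
  then show thesis using that[of C1 C2] that[of C2 C1] C by (auto simp: insert_commute)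
qed

text \<open>The superlevel set is the complement of the union of the disjoint closed sets
  \<open>{w \<le> c} \<union> Y1\<close> and \<open>Y2\<close>, neither of which separates the plane.\<close>

lemma superlevel_connected:
  fixes \<Omega> :: "(real \<times> real) set"
  assumes op: "open \<Omega>" and con: "connected \<Omega>" and bd: "bounded \<Omega>"
    and Y: "components (- \<Omega>) = {Y1, Y2}" "Y1 \<noteq> Y2"
    and \<Gamma>: "frontier \<Omega> = \<Gamma>1 \<union> \<Gamma>2" "\<Gamma>1 \<subseteq> Y1" "\<Gamma>2 \<subseteq> Y2" "\<Gamma>1 \<noteq> {}"
    and w: "continuous_on (closure \<Omega>) w" "\<And>x. x \<in> \<Gamma>2 \<Longrightarrow> w x > (c::real)"
    and touch: "\<And>U. U \<in> components {x \<in> \<Omega>. w x > c} \<Longrightarrow> closure U \<inter> \<Gamma>2 \<noteq> {}"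
  shows "connected {x \<in> \<Omega>. w x > c}"
proof -
  define A where "A = {x \<in> \<Omega>. w x > c}"
  define S where "S = {x \<in> closure \<Omega>. w x \<le> c} \<union> Y1"
  have Yc: "connected Y1" "connected Y2" "Y1 \<union> Y2 = - \<Omega>"
    using in_components_connected[of _ "- \<Omega>"] Union_components[of "- \<Omega>"] Y by auto
  have Yd: "Y1 \<inter> Y2 = {}" using Y components_nonoverlap[of Y1 "- \<Omega>" Y2] by auto
  have Ycl: "closed Y1" "closed Y2" using closed_components[of "- \<Omega>"] op Y by auto
  have fr: "x \<in> \<Gamma>1 \<union> \<Gamma>2" if "x \<in> closure \<Omega>" "x \<notin> \<Omega>" for x
    using that \<Gamma>(1) op by (auto simp: frontier_def interior_open)
  have AS: "- S = A \<union> Y2"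
  proof (intro equalityI subsetI)
    fix x assume x: "x \<in> - S"
    show "x \<in> A \<union> Y2"
    proof (cases "x \<in> \<Omega>")
      case True
      then have "x \<in> closure \<Omega>" using closure_subset by blast
      with x have "\<not> w x \<le> c" unfolding S_def by blast
      then show ?thesis using True unfolding A_def by simp
    next
      case False
      then show ?thesis using x Yc(3) unfolding S_def by blast
    qed
  next
    fix x assume x: "x \<in> A \<union> Y2"
    show "x \<in> - S"
    proof (cases "x \<in> \<Omega>")
      case True
      then have "x \<notin> Y1" "x \<notin> Y2" using Yc(3) by blast+
      then have "w x > c" using x unfolding A_def by blast
      then show ?thesis using \<open>x \<notin> Y1\<close> unfolding S_def by simp
    next
      case False
      then have "x \<in> Y2" using x by (auto simp: A_def)
      then have "w x > c" if "x \<in> closure \<Omega>" using fr[OF that False] w(2) \<Gamma>(2) Yd by blast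
      with \<open>x \<in> Y2\<close> show ?thesis using Yd by (auto simp: S_def)
    qed
  qed
  have clS: "closed S"
  proof -
    have "closed {x \<in> closure \<Omega>. w x \<le> c}"
      using continuous_closed_preimage[OF w(1) closed_closure, of "{..c}"] by (simp add: vimage_def Int_def)
    then show ?thesis unfolding S_def using Ycl by auto
  qed
  \<comment> \<open>Every component of \<open>A\<close> has a limit point on \<Gamma>2, hence in
    \<open>Y2\<close>, so attaching the connected set \<open>Y2\<close> joins all components
    together.\<close>
  have conn2: "connected_component (A \<union> Y2) a y" if a: "a \<in> A" and y: "y \<in> Y2" for a y
  proof -
    define U where "U = connected_component_set A a"
    have U: "U \<in> components A" using a by (simp add: U_def componentsI)
    have "connected U" "a \<in> U" "U \<subseteq> A" unfolding U_def using a connected_component_subset by auto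
    moreover obtain z where "z \<in> closure U" "z \<in> \<Gamma>2" using touch[of U] U unfolding A_def by blast
    ultimately have "connected (insert z U)"
      by (intro connected_intermediate_closure[of U "insert z U"]) (auto intro: closure_subset[THEN subsetD])
    then have "connected (insert z U \<union> Y2)"
      using Yc(2) \<open>z \<in> \<Gamma>2\<close> \<Gamma>(3) by (intro connected_Un) auto
    moreover have "insert z U \<union> Y2 \<subseteq> A \<union> Y2" using \<open>U \<subseteq> A\<close> \<open>z \<in> \<Gamma>2\<close> \<Gamma>(3) by auto
    ultimately show ?thesis using \<open>a \<in> U\<close> y unfolding connected_component_def by blast
  qed
  have Y2ne: "Y2 \<noteq> {}" using in_components_nonempty[of Y2 "- \<Omega>"] Y by auto
  have ccS: "connected_component (- S) a b" if "a \<in> A" "b \<in> A" for a b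
    unfolding AS using conn2[OF that(1)] conn2[OF that(2)] Y2ne
    by (meson connected_component_sym connected_component_trans ex_in_conv)
  \<comment> \<open>Off \<open>Y2\<close> the whole of \<Omega> is available; it is glued to
    \<open>Y1\<close> at a point of \<Gamma>1.\<close>
  have ccT: "connected_component (- Y2) a b" if "a \<in> A" "b \<in> A" for a b
  proof -
    obtain z where z: "z \<in> \<Gamma>1" using \<Gamma>(4) by auto
    then have "z \<in> closure \<Omega>" using \<Gamma>(1) by (auto simp: frontier_def)
    then have "connected (insert z \<Omega>)"
      by (intro connected_intermediate_closure[OF con]) (auto intro: closure_subset[THEN subsetD])
    then have "connected (insert z \<Omega> \<union> Y1)" using Yc(1) z \<Gamma>(2) by (intro connected_Un) auto
    moreover have "insert z \<Omega> \<union> Y1 \<subseteq> - Y2" using Yc(3) Yd z \<Gamma>(2) by blast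
    ultimately show ?thesis using that unfolding connected_component_def A_def by blast
  qed
  have disj: "S \<inter> Y2 = {}" using AS by blast
  have un: "- (S \<union> Y2) = A" using AS Yc(3) by (auto simp: A_def)
  \<comment> \<open>Janiszewski's theorem wants one compact set. The complement of a bounded set has
    only one unbounded component, so \<open>Y2\<close> or \<open>S\<close> is compact, and the
    theorem is applied with the roles chosen accordingly.\<close>
  have "bounded Y1 \<or> bounded Y2"
    using cobounded_unique_unbounded_components[of "- \<Omega>" Y1 Y2] bd Y by auto
  then have "connected_component A a b" if ab: "a \<in> A" "b \<in> A" for a b
  proof
    assume "bounded Y2"
    then have "compact Y2" using Ycl by (simp add: compact_eq_bounded_closed)
    from Janiszewski_plane[OF this clS _ ccT[OF ab] ccS[OF ab]] show ?thesis
      using disj un by (simp add: Int_commute Un_commute)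
  next
    assume "bounded Y1"
    moreover have "bounded {x \<in> closure \<Omega>. w x \<le> c}"
      using bounded_closure[OF bd] by (rule bounded_subset) auto
    ultimately have "compact S" using clS by (simp add: compact_eq_bounded_closed S_def)
    from Janiszewski_plane[OF this Ycl(2) _ ccS[OF ab] ccT[OF ab]] show ?thesis
      using disj un by simp
  qed
  then show ?thesis unfolding A_def[symmetric] by (simp add: connected_iff_connected_component)
qed

subsection \<open>Extrema and critical points of the height\<close>

text \<open>Open mapping: otherwise the image of \<open>V\<close> would contain f \<zeta> + e and f
  \<zeta> - e for some e > 0.\<close>

lemma holomorphic_Re_local_extremum_imp_constant:
  assumes f: "f holomorphic_on ball \<zeta>0 \<epsilon>" and V: "open V" "V \<subseteq> ball \<zeta>0 \<epsilon>" "\<zeta> \<in> V"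
    and max: "(\<forall>z\<in>V. Re (f z) \<le> Re (f \<zeta>)) \<or> (\<forall>z\<in>V. Re (f z) \<ge> Re (f \<zeta>))"
  shows "f constant_on ball \<zeta>0 \<epsilon>"
proof (rule ccontr)
  assume "\<not> f constant_on ball \<zeta>0 \<epsilon>"
  then have "open (f ` V)"
    using open_mapping_thm[OF f open_ball connected_ball V(1,2)] by simp
  then obtain e where e: "e > 0" "cball (f \<zeta>) e \<subseteq> f ` V"
    using V(3) open_contains_cball_eq by blast
  have "f \<zeta> + of_real e \<in> f ` V" "f \<zeta> - of_real e \<in> f ` V"
    using e by (auto intro!: subsetD[OF e(2)] simp: dist_norm)
  then obtain u v where "u \<in> V" "v \<in> V" "f \<zeta> + of_real e = f u" "f \<zeta> - of_real e = f v" by blast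
  moreover have "Re (f \<zeta> + of_real e) > Re (f \<zeta>)" "Re (f \<zeta> - of_real e) < Re (f \<zeta>)" using e by auto
  ultimately show False using max by (metis not_le)
qed

text \<open>The maximum of \<open>w\<close> over the closure of \<open>U\<close> exceeds c. At a
  point of \<Omega> it would belong to \<open>U\<close>, by maximality of components, and contradict
  \<open>nomax\<close>; so it sits on the frontier, and its height excludes \<Gamma>1.\<close>

lemma superlevel_component_touches_boundary:
  fixes \<Omega> :: "'a::euclidean_space set" and w :: "'a \<Rightarrow> real"
  assumes op: "open \<Omega>" and bd: "bounded \<Omega>" and cont: "continuous_on (closure \<Omega>) w"
    and nomax: "\<And>U x. open U \<Longrightarrow> x \<in> U \<Longrightarrow> U \<subseteq> \<Omega> \<Longrightarrow> (\<forall>y\<in>U. w y \<le> w x) \<Longrightarrow> False"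
    and U: "U \<in> components {x \<in> \<Omega>. w x > c}"
    and fr: "frontier \<Omega> = \<Gamma>1 \<union> \<Gamma>2" and le: "\<And>x. x \<in> \<Gamma>1 \<Longrightarrow> w x \<le> c"
  shows "closure U \<inter> \<Gamma>2 \<noteq> {}"
proof -
  let ?A = "{x \<in> \<Omega>. w x > c}"
  have UA: "U \<subseteq> ?A" using in_components_subset[OF U] .
  have cU: "closure U \<subseteq> closure \<Omega>" using UA by (intro closure_mono) auto
  have "continuous_on \<Omega> w" using cont closure_subset continuous_on_subset by blast
  then have "open (\<Omega> \<inter> w -` {c<..})" using op by (intro continuous_open_preimage) auto
  moreover have "\<Omega> \<inter> w -` {c<..} = ?A" by auto
  ultimately have "open ?A" by simp
  then have opU: "open U" using open_components U by blast
  obtain y where y: "y \<in> U" using in_components_nonempty[OF U] by auto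
  have "U \<subseteq> \<Omega>" using UA by blast
  then have k: "compact (closure U)" using bd by (simp add: bounded_subset)
  have ne: "closure U \<noteq> {}" using y closure_subset[of U] by blast
  obtain x where x: "x \<in> closure U" "\<And>v. v \<in> closure U \<Longrightarrow> w v \<le> w x"
    using continuous_attains_sup[OF k ne continuous_on_subset[OF cont cU]] by blast
  have "w y \<le> w x" using x(2) y closure_subset[of U] by blast
  moreover have "w y > c" using y UA by blast
  ultimately have wx: "w x > c" by linarith
  have "x \<notin> \<Omega>"
  proof
    assume "x \<in> \<Omega>"
    have "connected (insert x U)"
      using x(1) closure_subset[of U]
      by (intro connected_intermediate_closure[OF in_components_connected[OF U]]) blast+
    moreover have "insert x U \<subseteq> ?A" using UA wx \<open>x \<in> \<Omega>\<close> by auto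
    ultimately have "insert x U \<subseteq> U" using components_maximal[OF U, of "insert x U"] y by blast
    then have "x \<in> U" by blast
    moreover have "\<forall>v\<in>U. w v \<le> w x" using x(2) closure_subset[of U] by blast
    ultimately show False using nomax[OF opU _ \<open>U \<subseteq> \<Omega>\<close>] by blast
  qed
  moreover have "x \<in> closure \<Omega>" using x(1) cU by blast
  ultimately have "x \<in> \<Gamma>1 \<union> \<Gamma>2" using fr op by (auto simp: frontier_def interior_open)
  moreover have "x \<notin> \<Gamma>1" using le[of x] wx by linarith
  ultimately show ?thesis using x(1) by blast
qed

text \<open>With n the order of the first non-vanishing derivative, f - f \<zeta>0 is the n-th power
  of a function with a simple zero, and \<Phi> is the local inverse of that function. The vanishing
  first derivative gives n \<ge> 2.\<close>

lemma holomorphic_local_power: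
  assumes f: "f holomorphic_on ball \<zeta>0 \<epsilon>" and eps: "\<epsilon> > 0" and nc: "\<not> f constant_on ball \<zeta>0 \<epsilon>"
    and d0: "deriv f \<zeta>0 = 0"
  obtains n r \<Phi> where "n \<ge> 2" "r > 0" "continuous_on (ball 0 r) \<Phi>" "inj_on \<Phi> (ball 0 r)"
    "\<Phi> ` ball 0 r \<subseteq> ball \<zeta>0 \<epsilon>" "\<Phi> 0 = \<zeta>0" "\<And>w. w \<in> ball 0 r \<Longrightarrow> f (\<Phi> w) = f \<zeta>0 + w ^ n"
proof -
  have "\<exists>n>0. (deriv ^^ n) f \<zeta>0 \<noteq> 0"
  proof (rule ccontr)
    assume "\<not> ?thesis"
    then have "f constant_on ball \<zeta>0 \<epsilon>"
      using holomorphic_fun_eq_const_on_connected[OF f open_ball connected_ball, of \<zeta>0] eps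
      unfolding constant_on_def by (metis centre_in_ball)
    then show False using nc by blast
  qed
  then obtain n where n: "n > 0" "(deriv ^^ n) f \<zeta>0 \<noteq> 0" and
    nmin: "\<And>i. 0 < i \<Longrightarrow> i < n \<Longrightarrow> (deriv ^^ i) f \<zeta>0 = 0"
    using exists_least_iff[of "\<lambda>n. n > 0 \<and> (deriv ^^ n) f \<zeta>0 \<noteq> 0"] by blast
  have "n \<noteq> 1" using n(2) d0 by (metis funpow_0 funpow_simps_right(2) One_nat_def comp_apply)
  then have n2: "n \<ge> 2" using n(1) by linarith
  obtain g r1 where r1: "0 < r1" and g: "g holomorphic_on ball \<zeta>0 r1"
    and fg: "\<And>w. w \<in> ball \<zeta>0 r1 \<Longrightarrow> f w - f \<zeta>0 = ((w - \<zeta>0) * g w) ^ n"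
    and gnz: "\<And>w. w \<in> ball \<zeta>0 r1 \<Longrightarrow> g w \<noteq> 0"
    using holomorphic_factor_order_of_zero_strong[OF f open_ball _ n(1) n(2) nmin] eps
    by (metis centre_in_ball)
  define \<phi> where "\<phi> = (\<lambda>w. (w - \<zeta>0) * g w)"
  have hol: "\<phi> holomorphic_on ball \<zeta>0 r1" unfolding \<phi>_def using g by (intro holomorphic_intros)
  have c: "\<zeta>0 \<in> ball \<zeta>0 r1" using r1 by simp
  have "(\<phi> has_field_derivative g \<zeta>0) (at \<zeta>0)"
  proof -
    have "(g has_field_derivative deriv g \<zeta>0) (at \<zeta>0)" using g c holomorphic_derivI open_ball by blast
    then show ?thesis unfolding \<phi>_def by (auto intro!: derivative_eq_intros)
  qed
  then have "deriv \<phi> \<zeta>0 \<noteq> 0" using gnz[OF c] DERIV_imp_deriv by metis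
  then obtain r2 where r2: "r2 > 0" "ball \<zeta>0 r2 \<subseteq> ball \<zeta>0 r1" "inj_on \<phi> (ball \<zeta>0 r2)"
    using has_complex_derivative_locally_injective[OF hol c open_ball] by metis
  define B where "B = ball \<zeta>0 (min r2 \<epsilon>)"
  have B: "open B" "\<zeta>0 \<in> B" "B \<subseteq> ball \<zeta>0 r1" "B \<subseteq> ball \<zeta>0 \<epsilon>" "inj_on \<phi> B"
    using r2 eps unfolding B_def by (auto intro: inj_on_subset)
  have cB: "continuous_on B \<phi>" using hol B(3) holomorphic_on_imp_continuous_on holomorphic_on_subset by blast
  have "open (\<phi> ` B)" by (rule invariance_of_domain_gen[OF B(1) cB B(5)]) simp
  moreover have "0 \<in> \<phi> ` B" using B(2) by (auto simp: \<phi>_def intro: rev_image_eqI)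
  ultimately obtain r where r: "r > 0" "ball 0 r \<subseteq> \<phi> ` B" using openE by blast
  define \<Phi> where "\<Phi> = inv_into B \<phi>"
  have inv: "\<Phi> (\<phi> x) = x" if "x \<in> B" for x using that B(5) by (simp add: \<Phi>_def)
  have c\<Phi>: "continuous_on (\<phi> ` B) \<Phi>"
    by (rule continuous_on_inverse_open[OF B(1) cB]) (simp_all add: inv)
  have \<Phi>: "\<Phi> w \<in> B" "\<phi> (\<Phi> w) = w" if "w \<in> ball 0 r" for w
  proof -
    have "w \<in> \<phi> ` B" using that r(2) by blast
    then show "\<Phi> w \<in> B" "\<phi> (\<Phi> w) = w" unfolding \<Phi>_def by (rule inv_into_into, rule f_inv_into_f)
  qed
  show thesis
  proof (rule that[OF n2 r(1)])
    show "continuous_on (ball 0 r) \<Phi>" using c\<Phi> r(2) continuous_on_subset by blast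
    show "inj_on \<Phi> (ball 0 r)" using \<Phi>(2) by (rule inj_on_inverseI)
    show "\<Phi> ` ball 0 r \<subseteq> ball \<zeta>0 \<epsilon>" using \<Phi>(1) B(4) by blast
    show "\<Phi> 0 = \<zeta>0" using inv[OF B(2)] by (simp add: \<phi>_def)
    show "f (\<Phi> w) = f \<zeta>0 + w ^ n" if "w \<in> ball 0 r" for w
      using fg[of "\<Phi> w"] \<Phi>[OF that] B(3) unfolding \<phi>_def by (metis add.commute diff_add_cancel subsetD)
  qed
qed

section \<open>Maximum principle and curvature formulas for minimal graphs\<close>

context minimal_graph
begin

text \<open>\<open>G\<close> is the image of a chart and is fixed before \<open>y\<close> and
  \<open>V\<close>, so an extremum at any point of \<open>G\<close> makes the height constant on all
  of \<open>G\<close>. This uniformity lets constancy pass to limit points.\<close>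

lemma local_extremum_constant_nearby:
  assumes "z1 \<in> \<Omega>"
  obtains G where "open G" "z1 \<in> G" "G \<subseteq> \<Omega>"
    "\<And>V x y. open V \<Longrightarrow> y \<in> V \<Longrightarrow> y \<in> G \<Longrightarrow> x \<in> G \<Longrightarrow>
      (\<forall>v\<in>V. \<omega> v \<le> \<omega> y) \<or> (\<forall>v\<in>V. \<omega> v \<ge> \<omega> y) \<Longrightarrow> \<omega> x = \<omega> y"
proof -
  obtain X f g \<zeta>0 \<epsilon> where c: "\<epsilon> > 0" "X \<zeta>0 = z1" "continuous_on (ball \<zeta>0 \<epsilon>) X" "inj_on X (ball \<zeta>0 \<epsilon>)"
    "X ` ball \<zeta>0 \<epsilon> \<subseteq> \<Omega>" "f holomorphic_on ball \<zeta>0 \<epsilon>" and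
    fX: "\<And>\<zeta>. \<zeta> \<in> ball \<zeta>0 \<epsilon> \<Longrightarrow> Re (f \<zeta>) = \<omega> (X \<zeta>)"
    by (rule isothermal_chart[OF assms]) (rule that)
  show thesis
  proof (rule that)
    show "open (X ` ball \<zeta>0 \<epsilon>)" by (rule invariance_of_domain_gen[OF open_ball c(3,4)]) simp
    show "z1 \<in> X ` ball \<zeta>0 \<epsilon>" using c(1,2) by (metis centre_in_ball imageI)
    fix V x y assume V: "open V" "y \<in> V" "y \<in> X ` ball \<zeta>0 \<epsilon>" "x \<in> X ` ball \<zeta>0 \<epsilon>"
      "(\<forall>v\<in>V. \<omega> v \<le> \<omega> y) \<or> (\<forall>v\<in>V. \<omega> v \<ge> \<omega> y)"
    obtain \<zeta> \<zeta>' where z: "\<zeta> \<in> ball \<zeta>0 \<epsilon>" "y = X \<zeta>" "\<zeta>' \<in> ball \<zeta>0 \<epsilon>" "x = X \<zeta>'" using V(3,4) by blast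
    have "f constant_on ball \<zeta>0 \<epsilon>"
    proof (rule holomorphic_Re_local_extremum_imp_constant[OF c(6)])
      show "open (ball \<zeta>0 \<epsilon> \<inter> X -` V)" using c(3) V(1) by (intro continuous_open_preimage) auto
      show "\<zeta> \<in> ball \<zeta>0 \<epsilon> \<inter> X -` V" using z V(2) by auto
      show "(\<forall>z\<in>ball \<zeta>0 \<epsilon> \<inter> X -` V. Re (f z) \<le> Re (f \<zeta>)) \<or> (\<forall>z\<in>ball \<zeta>0 \<epsilon> \<inter> X -` V. Re (f \<zeta>) \<le> Re (f z))"
        using V(5) fX z(1) unfolding z(2) by fastforce
    qed auto
    then have "f \<zeta> = f \<zeta>'" using z unfolding constant_on_def by metis
    then show "\<omega> x = \<omega> y" using fX z by metis
  qed (use c in auto)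
qed

text \<open>The interior \<open>E\<close> of the level set is non-empty, open and relatively closed
  in the connected \<Omega>. No unique continuation is needed beyond that inside one chart.\<close>

lemma local_extremum_imp_constant:
  assumes con: "connected \<Omega>" and U: "open U" "z0 \<in> U" "U \<subseteq> \<Omega>"
    and ext: "(\<forall>v\<in>U. \<omega> v \<le> \<omega> z0) \<or> (\<forall>v\<in>U. \<omega> v \<ge> \<omega> z0)" and z: "z \<in> \<Omega>"
  shows "\<omega> z = \<omega> z0"
proof -
  define E where "E = interior {z \<in> \<Omega>. \<omega> z = \<omega> z0}"
  have EO: "E \<subseteq> \<Omega>" "\<And>x. x \<in> E \<Longrightarrow> \<omega> x = \<omega> z0"
    unfolding E_def using interior_subset by blast+
  \<comment> \<open>One criterion for two uses: at \<open>z0\<close> the extremum is given, while at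
    a limit point of \<open>E\<close> a nearby point of \<open>E\<close> is trivially an extremum,
    with \<open>V\<close> = \<open>E\<close>.\<close>
  have inE: "z1 \<in> E" if z1: "z1 \<in> \<Omega>" and acc: "\<And>G. open G \<Longrightarrow> z1 \<in> G \<Longrightarrow> \<exists>y V. y \<in> G \<and> y \<in> V \<and> open V \<and>
      \<omega> y = \<omega> z0 \<and> ((\<forall>v\<in>V. \<omega> v \<le> \<omega> y) \<or> (\<forall>v\<in>V. \<omega> v \<ge> \<omega> y))" for z1
  proof -
    obtain G where G: "open G" "z1 \<in> G" "G \<subseteq> \<Omega>" "\<And>V x y. open V \<Longrightarrow> y \<in> V \<Longrightarrow> y \<in> G \<Longrightarrow> x \<in> G \<Longrightarrow>
      (\<forall>v\<in>V. \<omega> v \<le> \<omega> y) \<or> (\<forall>v\<in>V. \<omega> v \<ge> \<omega> y) \<Longrightarrow> \<omega> x = \<omega> y"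
      by (rule local_extremum_constant_nearby[OF z1]) (rule that)
    obtain y V where y: "y \<in> G" "y \<in> V" "open V" "\<omega> y = \<omega> z0" and
      V: "(\<forall>v\<in>V. \<omega> v \<le> \<omega> y) \<or> (\<forall>v\<in>V. \<omega> v \<ge> \<omega> y)"
      using acc[OF G(1,2)] by blast
    have "\<omega> x = \<omega> z0" if "x \<in> G" for x
      using G(4)[OF y(3,2,1) that V] y(4) by simp
    then have "G \<subseteq> {z \<in> \<Omega>. \<omega> z = \<omega> z0}" using G(3) by blast
    then show ?thesis unfolding E_def using G(1,2) by (simp add: interiorI)
  qed
  have "z0 \<in> E"
  proof (rule inE)
    show "\<exists>y V. y \<in> G \<and> y \<in> V \<and> open V \<and> \<omega> y = \<omega> z0 \<and> ((\<forall>v\<in>V. \<omega> v \<le> \<omega> y) \<or> (\<forall>v\<in>V. \<omega> v \<ge> \<omega> y))"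
      if "z0 \<in> G" for G
      using U(1,2) ext that by (intro exI[of _ z0] exI[of _ U]) simp
  qed (use U in blast)
  moreover have "\<Omega> \<inter> closure E \<subseteq> E"
  proof
    fix z1 assume z1: "z1 \<in> \<Omega> \<inter> closure E"
    show "z1 \<in> E"
    proof (rule inE)
      fix G assume "open G" "z1 \<in> G"
      then obtain y where "y \<in> G" "y \<in> E" using z1 open_Int_closure_eq_empty[of G E] by blast
      moreover have "open E" by (simp add: E_def)
      ultimately show "\<exists>y V. y \<in> G \<and> y \<in> V \<and> open V \<and> \<omega> y = \<omega> z0 \<and> ((\<forall>v\<in>V. \<omega> v \<le> \<omega> y) \<or> (\<forall>v\<in>V. \<omega> v \<ge> \<omega> y))"
        using EO(2) by (intro exI[of _ y] exI[of _ E]) simp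
    qed (use z1 in auto)
  qed
  then have cover: "\<Omega> \<subseteq> E \<union> - closure E" by blast
  have opens: "open E" "open (- closure E)" unfolding E_def by (rule open_interior, rule open_Compl, rule closed_closure)
  have "E \<inter> - closure E \<inter> \<Omega> = {}" using closure_subset[of E] by blast
  from connectedD[OF con opens this cover] have "\<Omega> \<inter> - closure E = {}"
    using \<open>z0 \<in> E\<close> EO(1) by blast
  then have "z \<in> E" using z \<open>\<Omega> \<inter> closure E \<subseteq> E\<close> by blast
  then show ?thesis by (rule EO(2))
qed

text \<open>The expression is a positive multiple of the squared norm of the derivative of the
  holomorphic Gauss map.\<close>

lemma second_fundamental_form_sign:
  assumes "z \<in> \<Omega>"
  shows "(s z)\<^sup>2 - r z * t z \<ge> 0"
proof -
  obtain X \<zeta>0 \<epsilon> and g :: "complex \<Rightarrow> complex" where c: "\<epsilon> > 0" "X \<zeta>0 = z" and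
    gX: "\<And>\<zeta>. \<zeta> \<in> ball \<zeta>0 \<epsilon> \<Longrightarrow>
       (norm (deriv g \<zeta>))\<^sup>2 = ((s (X \<zeta>))\<^sup>2 - r (X \<zeta>) * t (X \<zeta>)) / ((1 + (q (X \<zeta>))\<^sup>2) * (1 + W (X \<zeta>))\<^sup>2)"
    by (rule isothermal_chart[OF assms]) (rule that)
  have "0 \<le> ((s z)\<^sup>2 - r z * t z) / ((1 + (q z)\<^sup>2) * (1 + W z)\<^sup>2)"
    using gX[of \<zeta>0] c by (metis centre_in_ball zero_le_power2)
  moreover have "(1 + (q z)\<^sup>2) * (1 + W z)\<^sup>2 > 0" by (simp add: add_pos_nonneg)
  ultimately show ?thesis by (simp add: zero_le_divide_iff)
qed

lemma gauss_curvature_formula: "gauss_curvature_graph \<omega> z = (r z * t z - (s z)\<^sup>2) / (W z) ^ 4"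
proof -
  have e: "(1 + (p z)\<^sup>2) * (1 + (q z)\<^sup>2) - (p z * q z)\<^sup>2 = (W z)\<^sup>2"
    unfolding W_sq by (simp add: power2_eq_square algebra_simps)
  have "gauss_curvature_graph \<omega> z = (r z / W z * (t z / W z) - (s z / W z)\<^sup>2) / (W z)\<^sup>2"
    using W_gt0[of z] unfolding gauss_curvature_graph_def Let_def r_def s_def t_def e[unfolded p_def q_def]
    by (simp add: less_imp_le)
  also have "\<dots> = (r z * t z - (s z)\<^sup>2) / (W z) ^ 4"
    by (simp add: power2_eq_square power4_eq_xxxx diff_divide_distrib)
  finally show ?thesis .
qed

end

text \<open>\<Gamma>1 and \<Gamma>2 stand for the plane projections of the boundary curves, each
  recorded with the complement component that contains it. The order \<open>lt\<close> is arranged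
  by exchanging the indices.\<close>

locale minimal_annulus = minimal_graph +
  fixes \<Gamma>1 \<Gamma>2 Y1 Y2 :: "(real \<times> real) set" and t1 t2 :: real
  assumes con: "connected \<Omega>" and bd: "bounded \<Omega>" and cont: "continuous_on (closure \<Omega>) \<omega>"
    and Y: "components (- \<Omega>) = {Y1, Y2}" "Y1 \<noteq> Y2"
    and fr: "frontier \<Omega> = \<Gamma>1 \<union> \<Gamma>2" "\<Gamma>1 \<subseteq> Y1" "\<Gamma>2 \<subseteq> Y2" "\<Gamma>1 \<noteq> {}" "\<Gamma>2 \<noteq> {}"
    and bval: "\<And>x. x \<in> \<Gamma>1 \<Longrightarrow> \<omega> x = t1" "\<And>x. x \<in> \<Gamma>2 \<Longrightarrow> \<omega> x = t2"
    and lt: "t1 < t2"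
begin

section \<open>Minimal annuli between two horizontal planes\<close>

lemma not_constant: "\<exists>z\<in>\<Omega>. \<omega> z \<noteq> c"
proof (rule ccontr)
  assume "\<not> ?thesis"
  then have "\<omega> z = c" if "z \<in> closure \<Omega>" for z
    using continuous_constant_on_closure[OF cont _ that] by blast
  moreover obtain x y where "x \<in> \<Gamma>1" "y \<in> \<Gamma>2" using fr by blast
  moreover from this have "x \<in> closure \<Omega>" "y \<in> closure \<Omega>" using fr(1) by (auto simp: frontier_def)
  ultimately show False using bval lt by (metis less_irrefl)
qed

lemma no_local_extremum:
  assumes "open U" "z \<in> U" "U \<subseteq> \<Omega>" "(\<forall>v\<in>U. \<omega> v \<le> \<omega> z) \<or> (\<forall>v\<in>U. \<omega> v \<ge> \<omega> z)"
  shows False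
  using local_extremum_imp_constant[OF con assms] not_constant by blast

lemma in_closure_cases:
  assumes "z \<in> closure \<Omega>" obtains "z \<in> \<Omega>" | "z \<in> \<Gamma>1" | "z \<in> \<Gamma>2"
  using assms fr(1) op by (auto simp: frontier_def interior_open)

lemma height_between:
  assumes z: "z \<in> \<Omega>"
  shows "t1 < \<omega> z" "\<omega> z < t2"
proof -
  have k: "compact (closure \<Omega>)" "closure \<Omega> \<noteq> {}" using bd z by (auto simp: compact_closure)
  have sub: "\<Omega> \<subseteq> closure \<Omega>" by (rule closure_subset)
  obtain x where x: "x \<in> closure \<Omega>" "\<And>v. v \<in> closure \<Omega> \<Longrightarrow> \<omega> v \<le> \<omega> x"
    using continuous_attains_sup[OF k cont] by blast
  have "x \<notin> \<Omega>" using no_local_extremum[OF op, of x] x(2) sub by blast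
  then have "\<omega> x \<le> t2" using x(1) bval lt by (cases rule: in_closure_cases[OF x(1)]) auto
  then have "\<omega> z \<noteq> t2" "\<omega> z \<le> t2"
    using no_local_extremum[OF op z] x(2) sub z by (metis dual_order.trans order_refl subsetD)+
  then show "\<omega> z < t2" by simp
  obtain x where x: "x \<in> closure \<Omega>" "\<And>v. v \<in> closure \<Omega> \<Longrightarrow> \<omega> x \<le> \<omega> v"
    using continuous_attains_inf[OF k cont] by blast
  have "x \<notin> \<Omega>" using no_local_extremum[OF op, of x] x(2) sub by blast
  then have "t1 \<le> \<omega> x" using x(1) bval lt by (cases rule: in_closure_cases[OF x(1)]) auto
  then have "\<omega> z \<noteq> t1" "t1 \<le> \<omega> z"
    using no_local_extremum[OF op z] x(2) sub z by (metis dual_order.trans order_refl subsetD)+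
  then show "t1 < \<omega> z" by simp
qed

text \<open>Components above the level can only reach \<Gamma>2. Sublevel sets are superlevel sets
  of - \<omega> and reach \<Gamma>1, so the second half repeats the argument with the two boundary
  parts exchanged.\<close>

lemma superlevels_connected:
  assumes "t1 < c" "c < t2"
  shows "connected {x \<in> \<Omega>. \<omega> x > c}" and "connected {x \<in> \<Omega>. - \<omega> x > - c}"
proof -
  show "connected {x \<in> \<Omega>. \<omega> x > c}"
  proof (rule superlevel_connected[OF op con bd Y fr(1-4) cont])
    show "closure U \<inter> \<Gamma>2 \<noteq> {}" if "U \<in> components {x \<in> \<Omega>. c < \<omega> x}" for U
    proof (rule superlevel_component_touches_boundary[OF op bd cont _ that fr(1)])
      show False if "open U" "x \<in> U" "U \<subseteq> \<Omega>" "\<forall>y\<in>U. \<omega> y \<le> \<omega> x" for U x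
        using no_local_extremum[OF that(1-3)] that(4) by blast
    qed (use bval assms in simp)
  qed (use bval assms in auto)
  have Y': "components (- \<Omega>) = {Y2, Y1}" and fr': "frontier \<Omega> = \<Gamma>2 \<union> \<Gamma>1" using Y fr(1) by auto
  have cont': "continuous_on (closure \<Omega>) (\<lambda>x. - \<omega> x)" using cont by (intro continuous_intros)
  show "connected {x \<in> \<Omega>. - \<omega> x > - c}"
  proof (rule superlevel_connected[OF op con bd Y' Y(2)[symmetric] fr' fr(3,2,5) cont'])
    show "closure U \<inter> \<Gamma>1 \<noteq> {}" if "U \<in> components {x \<in> \<Omega>. - c < - \<omega> x}" for U
    proof (rule superlevel_component_touches_boundary[OF op bd cont' _ that fr'])
      show False if "open U" "x \<in> U" "U \<subseteq> \<Omega>" "\<forall>y\<in>U. - \<omega> y \<le> - \<omega> x" for U x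
        using no_local_extremum[OF that(1-3)] that(4) by simp
    qed (use bval assms in simp)
  qed (use bval assms in auto)
qed

lemma no_critical_point:
  assumes z0: "z0 \<in> \<Omega>"
  shows "(p z0)\<^sup>2 + (q z0)\<^sup>2 > 0"
proof (rule ccontr)
  assume "\<not> ?thesis"
  then have pq: "(p z0)\<^sup>2 + (q z0)\<^sup>2 = 0" by (metis not_less antisym sum_power2_ge_zero)
  obtain X f \<zeta>0 \<epsilon> where c: "\<epsilon> > 0" "X \<zeta>0 = z0" "continuous_on (ball \<zeta>0 \<epsilon>) X" "inj_on X (ball \<zeta>0 \<epsilon>)"
    "X ` ball \<zeta>0 \<epsilon> \<subseteq> \<Omega>" "f holomorphic_on ball \<zeta>0 \<epsilon>" and
    fX: "\<And>\<zeta>. \<zeta> \<in> ball \<zeta>0 \<epsilon> \<Longrightarrow> Re (f \<zeta>) = \<omega> (X \<zeta>)" and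
    f': "\<And>\<zeta>. \<zeta> \<in> ball \<zeta>0 \<epsilon> \<Longrightarrow>
       (norm (deriv f \<zeta>))\<^sup>2 = ((p (X \<zeta>))\<^sup>2 + (q (X \<zeta>))\<^sup>2) / (1 + (q (X \<zeta>))\<^sup>2)"
    by (rule isothermal_chart[OF z0]) (rule that)
  have c0: "\<zeta>0 \<in> ball \<zeta>0 \<epsilon>" using c(1) by simp
  have d0: "deriv f \<zeta>0 = 0" using f'[OF c0] pq c(2) by simp
  have opX: "open (X ` ball \<zeta>0 \<epsilon>)" by (rule invariance_of_domain_gen[OF open_ball c(3,4)]) simp
  have nc: "\<not> f constant_on ball \<zeta>0 \<epsilon>"
  proof
    assume "f constant_on ball \<zeta>0 \<epsilon>"
    then obtain k where "\<And>\<zeta>. \<zeta> \<in> ball \<zeta>0 \<epsilon> \<Longrightarrow> \<omega> (X \<zeta>) = Re k" using fX unfolding constant_on_def by metis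
    then have "\<forall>v\<in>X ` ball \<zeta>0 \<epsilon>. \<omega> v \<le> \<omega> z0" using c0 c(2) by (metis image_iff order_refl)
    then show False using no_local_extremum[OF opX _ c(5)] c0 c(2) by (metis imageI)
  qed
  obtain n r \<Phi> where h: "n \<ge> 2" "r > 0" "continuous_on (ball 0 r) \<Phi>" "inj_on \<Phi> (ball 0 r)"
    "\<Phi> ` ball 0 r \<subseteq> ball \<zeta>0 \<epsilon>" "\<Phi> 0 = \<zeta>0" "\<And>w. w \<in> ball 0 r \<Longrightarrow> f (\<Phi> w) = f \<zeta>0 + w ^ n"
    using holomorphic_local_power[OF c(6,1) nc d0] by blast
  define \<psi> where "\<psi> = X \<circ> \<Phi>"
  have \<psi>\<Omega>: "\<psi> w \<in> \<Omega>" and val: "\<omega> (\<psi> w) = \<omega> z0 + Re (w ^ n)" if "w \<in> ball 0 r" for w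
  proof -
    have m: "\<Phi> w \<in> ball \<zeta>0 \<epsilon>" using h(5) that by blast
    then show "\<psi> w \<in> \<Omega>" using c(5) unfolding \<psi>_def by auto
    have "\<omega> (\<psi> w) = Re (f (\<Phi> w))" using fX[OF m] by (simp add: \<psi>_def)
    also have "\<dots> = Re (f \<zeta>0) + Re (w ^ n)" unfolding h(7)[OF that] by (rule plus_complex.sel)
    finally show "\<omega> (\<psi> w) = \<omega> z0 + Re (w ^ n)" using fX[OF c0] c(2) by simp
  qed
  note sl = superlevels_connected[OF height_between[OF z0]]
  show False
  proof (rule no_alternating_sectors[OF h(2) _ _ h(1) sl(1) _ sl(2)])
    show "continuous_on (ball 0 r) \<psi>" unfolding \<psi>_def
      by (rule continuous_on_compose[OF h(3) continuous_on_subset[OF c(3) h(5)]])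
    show "inj_on \<psi> (ball 0 r)" unfolding \<psi>_def by (rule comp_inj_on[OF h(4) inj_on_subset[OF c(4) h(5)]])
    have "open (\<Omega> \<inter> (\<lambda>x. - \<omega> x) -` {- \<omega> z0<..})"
      using op cont_second(1) by (intro continuous_open_preimage continuous_intros) auto
    moreover have "\<Omega> \<inter> (\<lambda>x. - \<omega> x) -` {- \<omega> z0<..} = {x \<in> \<Omega>. - \<omega> x > - \<omega> z0}" by auto
    ultimately show "open {x \<in> \<Omega>. - \<omega> x > - \<omega> z0}" by simp
    show "{x \<in> \<Omega>. \<omega> z0 < \<omega> x} \<inter> {x \<in> \<Omega>. - \<omega> z0 < - \<omega> x} = {}" by auto
    show "\<psi> w \<in> {x \<in> \<Omega>. \<omega> z0 < \<omega> x}" if "w \<in> ball 0 r" "0 < Re (w ^ n)" for w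
      using \<psi>\<Omega>[OF that(1)] val[OF that(1)] that(2) by simp
    show "(\<psi> w \<in> {x \<in> \<Omega>. - \<omega> z0 < - \<omega> x}) = (Re (w ^ n) < 0)" if "w \<in> ball 0 r" for w
      using \<psi>\<Omega>[OF that] val[OF that] by simp
    show "\<psi> 0 \<notin> {x \<in> \<Omega>. \<omega> z0 < \<omega> x}"
      using h(6) c(2) by (simp add: \<psi>_def)
  qed
qed

text \<open>This is \<open>|dg/df|\<^sup>2 / (1 - |g|\<^sup>2)\<^sup>2\<close>, which does not depend on the chart.\<close>

definition "gauss_density z = ((s z)\<^sup>2 - r z * t z) / (4 * ((p z)\<^sup>2 + (q z)\<^sup>2))"

text \<open>Because d < t2 - t1, the set \<open>K\<close> stays away from the frontier and is
  compact in \<Omega>, while the weight cos^2 vanishes where |\<omega> - m| = d / 2. A positive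
  maximum of \<Theta> on \<open>K\<close> is thus a local maximum in a chart, and the weight is 1 at
  height m.\<close>

lemma density_bound:
  fixes d :: real
  defines "m \<equiv> (t1 + t2) / 2"
  assumes d: "0 < d" "d < t2 - t1" and z: "z \<in> \<Omega>" "\<omega> z = m"
  shows "4 * gauss_density z \<le> (pi / d)\<^sup>2"
proof -
  define k where "k = pi / d"
  define K where "K = {x \<in> closure \<Omega>. \<bar>\<omega> x - m\<bar> \<le> d / 2}"
  have kd: "k > 0" "k * (d / 2) = pi / 2" using d by (auto simp: k_def)
  have K\<Omega>: "K \<subseteq> \<Omega>"
  proof
    fix x assume x: "x \<in> K"
    then have "x \<in> closure \<Omega>" "\<bar>\<omega> x - m\<bar> \<le> d / 2" by (auto simp: K_def)
    moreover have "\<bar>t1 - m\<bar> > d / 2" "\<bar>t2 - m\<bar> > d / 2" using d by (auto simp: m_def abs_if field_simps)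
    ultimately show "x \<in> \<Omega>" using bval by (cases rule: in_closure_cases[of x]) auto
  qed
  have "closed (closure \<Omega> \<inter> (\<lambda>x. \<bar>\<omega> x - m\<bar>) -` {..d / 2})"
    by (intro continuous_closed_preimage continuous_intros cont) auto
  moreover have "closure \<Omega> \<inter> (\<lambda>x. \<bar>\<omega> x - m\<bar>) -` {..d / 2} = K" by (auto simp: K_def)
  ultimately have "closed K" by simp
  moreover have "bounded K" using bounded_closure[OF bd] by (rule bounded_subset) (auto simp: K_def)
  ultimately have "compact K" by (simp add: compact_eq_bounded_closed)
  define \<Theta> where "\<Theta> x = gauss_density x * (cos (k * (\<omega> x - m)))\<^sup>2" for x
  have "continuous_on \<Omega> \<Theta>" unfolding \<Theta>_def gauss_density_def
    by (intro continuous_intros cont_second) (use no_critical_point in force)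
  then have "continuous_on K \<Theta>" using K\<Omega> continuous_on_subset by blast
  moreover have zK: "z \<in> K" using z d closure_subset[of \<Omega>] by (auto simp: K_def)
  ultimately obtain x0 where x0: "x0 \<in> K" "\<And>x. x \<in> K \<Longrightarrow> \<Theta> x \<le> \<Theta> x0"
    using continuous_attains_sup[OF \<open>compact K\<close>] by blast
  have x0\<Omega>: "x0 \<in> \<Omega>" using x0 K\<Omega> by blast
  have \<Theta>z: "\<Theta> z = gauss_density z" using z by (simp add: \<Theta>_def)
  have "4 * \<Theta> x0 \<le> k\<^sup>2"
  proof (cases "\<Theta> x0 \<le> 0")
    \<comment> \<open>A positive maximum has a non-zero cosine, so \<open>x0\<close> is not on the
      levels |\<omega> - m| = d / 2.\<close>
    case False
    then have "cos (k * (\<omega> x0 - m)) \<noteq> 0" by (auto simp: \<Theta>_def)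
    have "\<bar>\<omega> x0 - m\<bar> \<noteq> d / 2"
    proof
      assume "\<bar>\<omega> x0 - m\<bar> = d / 2"
      then have "\<omega> x0 - m = d / 2 \<or> \<omega> x0 - m = - (d / 2)" by linarith
      then have "k * (\<omega> x0 - m) = pi / 2 \<or> k * (\<omega> x0 - m) = - (pi / 2)"
        using kd(2) by (metis mult_minus_right)
      then show False
        using \<open>cos (k * (\<omega> x0 - m)) \<noteq> 0\<close> cos_pi_half cos_minus[of "pi / 2"] by metis
    qed
    then have strict: "\<bar>\<omega> x0 - m\<bar> < d / 2" using x0(1) by (auto simp: K_def)
    obtain X f g \<zeta>0 \<epsilon> where c: "\<epsilon> > 0" "X \<zeta>0 = x0" "X ` ball \<zeta>0 \<epsilon> \<subseteq> \<Omega>"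
      "f holomorphic_on ball \<zeta>0 \<epsilon>" "g holomorphic_on ball \<zeta>0 \<epsilon>" and
      fX: "\<And>\<zeta>. \<zeta> \<in> ball \<zeta>0 \<epsilon> \<Longrightarrow> Re (f \<zeta>) = \<omega> (X \<zeta>)" and
      f': "\<And>\<zeta>. \<zeta> \<in> ball \<zeta>0 \<epsilon> \<Longrightarrow>
       (norm (deriv f \<zeta>))\<^sup>2 = ((p (X \<zeta>))\<^sup>2 + (q (X \<zeta>))\<^sup>2) / (1 + (q (X \<zeta>))\<^sup>2)" and
      gX: "\<And>\<zeta>. \<zeta> \<in> ball \<zeta>0 \<epsilon> \<Longrightarrow> (norm (g \<zeta>))\<^sup>2 = ((p (X \<zeta>))\<^sup>2 + (q (X \<zeta>))\<^sup>2) / (1 + W (X \<zeta>))\<^sup>2" and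
      g': "\<And>\<zeta>. \<zeta> \<in> ball \<zeta>0 \<epsilon> \<Longrightarrow>
       (norm (deriv g \<zeta>))\<^sup>2 = ((s (X \<zeta>))\<^sup>2 - r (X \<zeta>) * t (X \<zeta>)) / ((1 + (q (X \<zeta>))\<^sup>2) * (1 + W (X \<zeta>))\<^sup>2)"
      by (rule isothermal_chart[OF x0\<Omega>]) (rule that)
    have c0: "\<zeta>0 \<in> ball \<zeta>0 \<epsilon>" using c(1) by simp
    \<comment> \<open>Shrinking the chart disc into \<open>V\<close> keeps its image inside
      \<open>K\<close>, where \<Theta> is known to be at most its value at
      \<open>x0\<close>.\<close>
    define V where "V = ball \<zeta>0 \<epsilon> \<inter> (\<lambda>\<zeta>. \<bar>Re (f \<zeta>) - m\<bar>) -` {..<d / 2}"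
    have "open V" unfolding V_def
      by (intro continuous_open_preimage continuous_intros holomorphic_on_imp_continuous_on c(4)) auto
    moreover have "\<zeta>0 \<in> V" using c0 strict fX[OF c0] c(2) by (simp add: V_def)
    ultimately obtain \<delta> where \<delta>: "\<delta> > 0" "ball \<zeta>0 \<delta> \<subseteq> V" using openE by blast
    have sub: "ball \<zeta>0 \<delta> \<subseteq> ball \<zeta>0 \<epsilon>" using \<delta>(2) by (auto simp: V_def)
    have X\<Omega>: "X \<zeta> \<in> \<Omega>" if "\<zeta> \<in> ball \<zeta>0 \<epsilon>" for \<zeta> using c(3) that by blast
    have one: "1 - (norm (g \<zeta>))\<^sup>2 = 2 / (1 + W (X \<zeta>))" if "\<zeta> \<in> ball \<zeta>0 \<epsilon>" for \<zeta>
    proof -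
      have "(p (X \<zeta>))\<^sup>2 + (q (X \<zeta>))\<^sup>2 = (W (X \<zeta>) - 1) * (1 + W (X \<zeta>))"
        using W_sq[of "X \<zeta>"] by (simp add: power2_eq_square algebra_simps)
      then have "(norm (g \<zeta>))\<^sup>2 = (W (X \<zeta>) - 1) / (1 + W (X \<zeta>))"
        using gX[OF that] by (simp add: power2_eq_square)
      then show ?thesis by (simp add: field_simps)
    qed
    \<comment> \<open>By \<open>one\<close>, (1 - |g|^2)^2 = 4 / (1 + W)^2; this removes (1 + W)^2,
      and the factor 1 + q^2 cancels between the two derivatives.\<close>
    have dens_eq: "(norm (deriv g \<zeta>))\<^sup>2 / ((norm (deriv f \<zeta>))\<^sup>2 * (1 - (norm (g \<zeta>))\<^sup>2)\<^sup>2)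
        * (cos (k * (Re (f \<zeta>) - m)))\<^sup>2 = \<Theta> (X \<zeta>)" if "\<zeta> \<in> ball \<zeta>0 \<epsilon>" for \<zeta>
    proof -
      have n1: "1 + (q (X \<zeta>))\<^sup>2 \<noteq> 0" by (metis add_pos_nonneg less_irrefl zero_le_power2 zero_less_one)
      have n2: "(p (X \<zeta>))\<^sup>2 + (q (X \<zeta>))\<^sup>2 \<noteq> 0" using no_critical_point[OF X\<Omega>[OF that]] by linarith
      have alg: "A / (b * w\<^sup>2) / (C / b * (2 / w)\<^sup>2) = A / (4 * C)"
        if "b \<noteq> 0" "w \<noteq> 0" "C \<noteq> 0" for A b w C :: real
        using that by (simp add: field_simps power2_eq_square)
      show ?thesis
        unfolding \<Theta>_def gauss_density_def fX[OF that] f'[OF that] g'[OF that] one[OF that]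
          alg[OF n1 W_nz(2) n2] by (rule refl)
    qed
    have "4 * ((norm (deriv g \<zeta>0))\<^sup>2 / ((norm (deriv f \<zeta>0))\<^sup>2 * (1 - (norm (g \<zeta>0))\<^sup>2)\<^sup>2)
        * (cos (k * (Re (f \<zeta>0) - m)))\<^sup>2) \<le> k\<^sup>2"
    proof (rule hyperbolic_density_at_max[OF \<delta>(1)])
      show "f holomorphic_on ball \<zeta>0 \<delta>" "g holomorphic_on ball \<zeta>0 \<delta>"
        using c(4,5) sub holomorphic_on_subset by blast+
      show "norm (g \<zeta>) < 1" if "\<zeta> \<in> ball \<zeta>0 \<delta>" for \<zeta>
      proof -
        have "\<zeta> \<in> ball \<zeta>0 \<epsilon>" using that sub by blast
        from one[OF this] have "1 - (norm (g \<zeta>))\<^sup>2 > 0" using W_gt0[of "X \<zeta>"] by simp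
        then show ?thesis by (simp add: power_less_one_iff)
      qed
      have "(norm (deriv f \<zeta>0))\<^sup>2 > 0"
        using f'[OF c0] no_critical_point[OF X\<Omega>[OF c0]] by (simp add: add_pos_nonneg)
      then show "deriv f \<zeta>0 \<noteq> 0" by auto
      show "deriv g \<zeta>0 \<noteq> 0"
      proof
        assume "deriv g \<zeta>0 = 0"
        then have "\<Theta> x0 = 0" using dens_eq[OF c0] c(2) by simp
        then show False using False by simp
      qed
      have "\<bar>k * (\<omega> x0 - m)\<bar> < pi / 2"
        unfolding abs_mult kd(2)[symmetric] using kd(1) strict by simp
      then have "cos (k * (\<omega> x0 - m)) > 0" by (intro cos_gt_zero_pi) auto
      then show "cos (k * (Re (f \<zeta>0) - m)) > 0" using fX[OF c0] c(2) by simp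
      fix \<zeta> assume "\<zeta> \<in> ball \<zeta>0 \<delta>"
      then have \<zeta>: "\<zeta> \<in> ball \<zeta>0 \<epsilon>" "\<zeta> \<in> V" using sub \<delta>(2) by auto
      then have "X \<zeta> \<in> K"
        using X\<Omega>[OF \<zeta>(1)] fX[OF \<zeta>(1)] closure_subset[of \<Omega>] by (auto simp: K_def V_def)
      then show "(norm (deriv g \<zeta>))\<^sup>2 / ((norm (deriv f \<zeta>))\<^sup>2 * (1 - (norm (g \<zeta>))\<^sup>2)\<^sup>2)
        * (cos (k * (Re (f \<zeta>) - m)))\<^sup>2 \<le>
        (norm (deriv g \<zeta>0))\<^sup>2 / ((norm (deriv f \<zeta>0))\<^sup>2 * (1 - (norm (g \<zeta>0))\<^sup>2)\<^sup>2)
        * (cos (k * (Re (f \<zeta>0) - m)))\<^sup>2"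
        unfolding dens_eq[OF \<zeta>(1)] dens_eq[OF c0] c(2) by (rule x0(2))
    qed
    then show ?thesis unfolding dens_eq[OF c0] c(2) .
  qed (metis mult_nonneg_nonpos order_trans zero_le_numeral zero_le_power2)
  then show ?thesis using x0(2)[OF zK] \<Theta>z unfolding k_def by linarith
qed

text \<open>The density bound holds for every strip width below t2 - t1; the limit from the left
  gives it for the full width.\<close>

lemma curvature_bound:
  assumes z: "z \<in> \<Omega>" "\<omega> z = (t1 + t2) / 2"
  shows "\<bar>gauss_curvature_graph \<omega> z\<bar> \<le> pi\<^sup>2 / (t2 - t1)\<^sup>2"
proof -
  have "4 * gauss_density z \<le> (pi / (t2 - t1))\<^sup>2"
  proof (rule tendsto_lowerbound)
    show "((\<lambda>d. (pi / d)\<^sup>2) \<longlongrightarrow> (pi / (t2 - t1))\<^sup>2) (at_left (t2 - t1))"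
      using lt by (intro tendsto_intros) auto
    show "\<forall>\<^sub>F d in at_left (t2 - t1). 4 * gauss_density z \<le> (pi / d)\<^sup>2"
      using eventually_at_left_real[of 0 "t2 - t1"] lt density_bound[OF _ _ z]
      by (auto elim!: eventually_mono)
  qed simp
  then have D: "(s z)\<^sup>2 - r z * t z \<le> (pi / (t2 - t1))\<^sup>2 * ((p z)\<^sup>2 + (q z)\<^sup>2)"
  proof -
    have "4 * (A / (4 * C)) = A / C" for A C :: real by simp
    then have "((s z)\<^sup>2 - r z * t z) / ((p z)\<^sup>2 + (q z)\<^sup>2) \<le> (pi / (t2 - t1))\<^sup>2"
      using \<open>4 * gauss_density z \<le> (pi / (t2 - t1))\<^sup>2\<close> unfolding gauss_density_def by metis
    then show ?thesis using no_critical_point[OF z(1)] by (simp only: pos_divide_le_eq)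
  qed
  \<comment> \<open>This is W^2 - 1 \<le> W^4. The quotient (W^2 - 1) / W^4 never exceeds 1/4, so
    the estimate gives away a factor 4.\<close>
  have W4: "(p z)\<^sup>2 + (q z)\<^sup>2 \<le> (W z) ^ 4"
  proof -
    have "(W z)\<^sup>2 \<ge> 1" using W_ge1[of z] by simp
    then have "(W z)\<^sup>2 * 1 \<le> (W z)\<^sup>2 * (W z)\<^sup>2" by (intro mult_left_mono) auto
    moreover have "(W z)\<^sup>2 * (W z)\<^sup>2 = (W z) ^ 4" by (simp flip: power_add)
    ultimately show ?thesis using W_sq[of z] by linarith
  qed
  have "\<bar>gauss_curvature_graph \<omega> z\<bar> = ((s z)\<^sup>2 - r z * t z) / (W z) ^ 4"
    unfolding gauss_curvature_formula abs_divide using second_fundamental_form_sign[OF z(1)] by simp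
  also have "\<dots> \<le> (pi / (t2 - t1))\<^sup>2 * ((p z)\<^sup>2 + (q z)\<^sup>2) / (W z) ^ 4"
    using D by (rule divide_right_mono) simp
  also have "\<dots> \<le> (pi / (t2 - t1))\<^sup>2"
  proof -
    have "(pi / (t2 - t1))\<^sup>2 * ((p z)\<^sup>2 + (q z)\<^sup>2) \<le> (pi / (t2 - t1))\<^sup>2 * (W z) ^ 4"
      using W4 by (intro mult_left_mono) auto
    then show ?thesis using W_gt0[of z] by (simp add: pos_divide_le_eq)
  qed
  finally show ?thesis by (simp add: power_divide)
qed

end

subsection \<open>Tangent planes\<close>

lemma horizontal_tangent_plane:
  assumes "horizontal (tangent_plane w p)"
  shows "pd1 w p = 0" "pd2 w p = 0"
proof -
  let ?S = "span {((1, 0), pd1 w p), ((0, 1), pd2 w p)} :: ((real \<times> real) \<times> real) set"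
  obtain h where h: "tangent_plane w p = horizontal_plane_at h" using assms unfolding horizontal_def by blast
  have in_plane: "w p + snd x = h" if "x \<in> ?S" for x
  proof -
    have "(p, w p) + x \<in> horizontal_plane_at h" using that unfolding h[symmetric] tangent_plane_def by blast
    then show ?thesis by (cases x) (simp add: horizontal_plane_at_def)
  qed
  have "w p = h" using in_plane[OF span_zero] by simp
  moreover have "w p + pd1 w p = h" "w p + pd2 w p = h"
    using in_plane[OF span_base[of "((1, 0), pd1 w p)"]] in_plane[OF span_base[of "((0, 1), pd2 w p)"]] by simp_all
  ultimately show "pd1 w p = 0" "pd2 w p = 0" by simp_all
qed

text \<open>A vector in the span is determined by its horizontal part, so (0, 0, 1) is not among
  them.\<close>

lemma not_vertical_tangent_plane: "\<not> vertical (tangent_plane w p)"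
proof
  let ?a = "((1::real, 0::real), pd1 w p)" and ?b = "((0::real, 1::real), pd2 w p)"
  assume v: "vertical (tangent_plane w p)"
  have "(p, w p) + 0 \<in> tangent_plane w p" unfolding tangent_plane_def using span_zero by blast
  then have "(p, w p) + 0 + 1 *\<^sub>R ((0, 0), 1) \<in> tangent_plane w p" using v unfolding vertical_def by blast
  then obtain x where x: "x \<in> span {?a, ?b}" "(p, w p) + 0 + 1 *\<^sub>R ((0, 0), 1) = (p, w p) + x"
    unfolding tangent_plane_def by blast
  have xe: "x = ((0, 0), 1)" using x(2) by (simp add: prod_eq_iff)
  obtain a b where "x = a *\<^sub>R ?a + b *\<^sub>R ?b"
    using x(1) unfolding span_insert span_empty by (auto simp: algebra_simps)
  then show False using xe by (auto simp: prod_eq_iff)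
qed

theorem theorem1p1:
  fixes \<Omega> :: "(real \<times> real) set"
    and \<omega> :: "real \<times> real \<Rightarrow> real"
    and \<Sigma> \<gamma>1 \<gamma>2 :: "((real \<times> real) \<times> real) set"
    and t1 t2 d :: real
  assumes dom: "doubly_connected_domain \<Omega>" "bounded \<Omega>"
    and reg: "C2_on \<Omega> \<omega>" "continuous_on (closure \<Omega>) \<omega>"
    and mse: "minimal_surface_eq \<Omega> \<omega>"
    and graph: "\<Sigma> = graph_over \<omega> \<Omega>"
    and bdry: "graph_over \<omega> (frontier \<Omega>) = \<gamma>1 \<union> \<gamma>2"
    and jc: "jordan_curve \<gamma>1" "jordan_curve \<gamma>2"
    and planes: "\<gamma>1 \<subseteq> horizontal_plane_at t1" "\<gamma>2 \<subseteq> horizontal_plane_at t2"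
    and dist: "d = \<bar>t1 - t2\<bar>" "d > 0"
  shows "(\<forall>\<zeta> \<in> \<Sigma> \<inter> horizontal_plane_at ((t1 + t2) / 2).
            \<bar>gauss_curvature_graph \<omega> (fst \<zeta>)\<bar> \<le> pi\<^sup>2 / d\<^sup>2)
       \<and> (\<forall>\<zeta> \<in> \<Sigma> - (\<gamma>1 \<union> \<gamma>2).
            \<not> horizontal (tangent_plane \<omega> (fst \<zeta>)) \<and> \<not> vertical (tangent_plane \<omega> (fst \<zeta>)))"
proof -
  have op: "open \<Omega>" and con: "connected \<Omega>" and two: "card (components (- \<Omega>)) = 2"
    using dom(1) unfolding doubly_connected_domain_def by (simp_all add: Compl_eq_Diff_UNIV)
  interpret minimal_graph \<Omega> \<omega> using op reg(1) mse by unfold_locales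
  \<comment> \<open>As continuous images of closed paths these projections are connected and
    non-empty, and together they form the frontier of \<Omega>.\<close>
  define \<Gamma>1 \<Gamma>2 where "\<Gamma>1 = fst ` \<gamma>1" and "\<Gamma>2 = fst ` \<gamma>2"
  have jordan: "connected \<gamma>" "\<gamma> \<noteq> {}" if "jordan_curve \<gamma>" for \<gamma>
    using that unfolding jordan_curve_def
    by (metis connected_path_image simple_path_imp_path, metis path_image_nonempty)
  have con\<Gamma>: "connected \<Gamma>1" "connected \<Gamma>2" and ne: "\<Gamma>1 \<noteq> {}" "\<Gamma>2 \<noteq> {}"
    unfolding \<Gamma>1_def \<Gamma>2_def using jordan[OF jc(1)] jordan[OF jc(2)]
    by (auto intro!: connected_continuous_image continuous_intros)
  have "fst ` graph_over \<omega> (frontier \<Omega>) = frontier \<Omega>" by (force simp: graph_over_def)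
  then have fr: "frontier \<Omega> = \<Gamma>1 \<union> \<Gamma>2" unfolding bdry \<Gamma>1_def \<Gamma>2_def by auto
  then have "\<Omega> \<noteq> {}" using ne by auto
  have bv: "\<omega> (fst y) = h" if "y \<in> \<gamma>1 \<union> \<gamma>2" "y \<in> horizontal_plane_at h" for y h
    using that unfolding bdry[symmetric] by (auto simp: graph_over_def horizontal_plane_at_def)
  have bval: "\<And>x. x \<in> \<Gamma>1 \<Longrightarrow> \<omega> x = t1" "\<And>x. x \<in> \<Gamma>2 \<Longrightarrow> \<omega> x = t2"
    unfolding \<Gamma>1_def \<Gamma>2_def using bv planes by blast+
  obtain Y1 Y2 where Y: "components (- \<Omega>) = {Y1, Y2}" "Y1 \<noteq> Y2" "\<Gamma>1 \<subseteq> Y1" "\<Gamma>2 \<subseteq> Y2"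
    by (rule frontier_parts_in_complement_components[OF op \<open>\<Omega> \<noteq> {}\<close> two fr con\<Gamma>])
  \<comment> \<open>Neither claim depends on the order of the two heights, so both interpretations
    of the annulus locale can deliver them.\<close>
  have "(\<forall>z\<in>\<Omega>. (p z)\<^sup>2 + (q z)\<^sup>2 > 0) \<and>
      (\<forall>z\<in>\<Omega>. \<omega> z = (t1 + t2) / 2 \<longrightarrow> \<bar>gauss_curvature_graph \<omega> z\<bar> \<le> pi\<^sup>2 / d\<^sup>2)"
  proof (cases "t1 < t2")
    case True
    then interpret minimal_annulus \<Omega> \<omega> \<Gamma>1 \<Gamma>2 Y1 Y2 t1 t2
      using con dom(2) reg(2) Y fr ne bval by unfold_locales auto
    show ?thesis using no_critical_point curvature_bound dist True by (simp add: power2_commute)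
  next
    case False
    then have "t2 < t1" using dist by auto
    \<comment> \<open>The annulus is read with both index pairs exchanged; the middle height is
      symmetric in \<open>t1\<close> and \<open>t2\<close>.\<close>
    then interpret minimal_annulus \<Omega> \<omega> \<Gamma>2 \<Gamma>1 Y2 Y1 t2 t1
      using con dom(2) reg(2) Y fr ne bval by unfold_locales auto
    show ?thesis using no_critical_point curvature_bound dist \<open>t2 < t1\<close>
      by (simp add: add.commute)
  qed
  then have nocrit: "(p z)\<^sup>2 + (q z)\<^sup>2 > 0"
    and curv: "\<omega> z = (t1 + t2) / 2 \<Longrightarrow> \<bar>gauss_curvature_graph \<omega> z\<bar> \<le> pi\<^sup>2 / d\<^sup>2" if "z \<in> \<Omega>" for z
    using that by blast+
  show ?thesis
  proof (intro conjI ballI)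
    fix \<zeta> assume "\<zeta> \<in> \<Sigma> \<inter> horizontal_plane_at ((t1 + t2) / 2)"
    then obtain z where "z \<in> \<Omega>" "\<zeta> = (z, \<omega> z)" "\<omega> z = (t1 + t2) / 2"
      unfolding graph graph_over_def horizontal_plane_at_def by blast
    then show "\<bar>gauss_curvature_graph \<omega> (fst \<zeta>)\<bar> \<le> pi\<^sup>2 / d\<^sup>2" using curv by simp
  next
    fix \<zeta> assume "\<zeta> \<in> \<Sigma> - (\<gamma>1 \<union> \<gamma>2)"
    then have "fst \<zeta> \<in> \<Omega>" unfolding graph graph_over_def by auto
    then show "\<not> horizontal (tangent_plane \<omega> (fst \<zeta>))"
      using nocrit[of "fst \<zeta>"] horizontal_tangent_plane[of \<omega> "fst \<zeta>"] unfolding p_def q_def by auto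
  qed (rule not_vertical_tangent_plane)
qed

end
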